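(* There are algorithms running in time $2^n\cdot n^{O(1)}$ that, given a graph $G$ on $n$ vertices and a vertex $z\in V(G)$, decide whether $z$ is the end vertex of some ordering of $G$ produced by, respectively, maximum cardinality search (\textsc{mcs}), breadth-first search (\textsc{bfs}), and depth-first search (\textsc{dfs}).
   Context: The end vertex of an ordering $v_1,\dots,v_n$ of $V(G)$ is $v_n$. An \textsc{mcs} ordering: $v_1$ arbitrary, and each $v_i$ ($i\ge2$) is an unvisited vertex with the maximum number of neighbors among $v_1,\dots,v_{i-1}$ (ties arbitrary). A \textsc{bfs} ordering: the order in which vertices are first visited by breadth-first search with arbitrary tie-breaking (a start vertex is enqueued; repeatedly the front vertex is dequeued and its unvisited neighbors are visited and enqueued in arbitrary order). A \textsc{dfs} ordering: the order in which vertices are first visited by depth-first search with arbitrary tie-breaking (from the current vertex, an arbitrary unvisited neighbor is visited next; if none exists, the search backtracks to the vertex that discovered the current one). *)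

theory Defs
  imports Complex_Main "HOL-Library.Log_Nat" "HOL-Library.Landau_Symbols"
begin

section \<open>Random access machine with logarithmic cost\<close>

text \<open>
  Algorithms are programs of a structured random access machine.  The memory consists of
  unboundedly long arrays of natural numbers, the arrays being named by natural numbers.
  Array names are constants of the program, so each program uses finitely many arrays;
  indices are computed.

  Time is measured by the logarithmic cost criterion: every operation is charged the lengths
  of the binary representations of the numbers it handles, indices included.  (Under unit
  cost, arithmetic on very long numbers would be unrealistically cheap.)
\<close>

datatype binop = Plus | Monus | Times | Div | Mod | Less | Equal

datatype expr =
    Const nat
  | Load nat expr
  | Binop binop expr expr

datatype com =
    Skip
  | Store nat expr expr
  | Seq com com
  | Cond expr com com
  | While expr com

type_synonym memory = "nat \<Rightarrow> nat \<Rightarrow> nat"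

definition len :: "nat \<Rightarrow> nat" where
  "len x = max 1 (floorlog 2 x)"

fun apply_binop :: "binop \<Rightarrow> nat \<Rightarrow> nat \<Rightarrow> nat" where
  "apply_binop Plus x y = x + y"
| "apply_binop Monus x y = x - y"
| "apply_binop Times x y = x * y"
| "apply_binop Div x y = x div y"
| "apply_binop Mod x y = x mod y"
| "apply_binop Less x y = (if x < y then 1 else 0)"
| "apply_binop Equal x y = (if x = y then 1 else 0)"

fun val :: "expr \<Rightarrow> memory \<Rightarrow> nat" where
  "val (Const k) m = k"
| "val (Load a e) m = m a (val e m)"
| "val (Binop f e1 e2) m = apply_binop f (val e1 m) (val e2 m)"

fun cost :: "expr \<Rightarrow> memory \<Rightarrow> nat" where
  "cost (Const k) m = len k"
| "cost (Load a e) m = cost e m + len (val e m) + len (m a (val e m))"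
| "cost (Binop f e1 e2) m = cost e1 m + cost e2 m + len (val e1 m) + len (val e2 m)"

text \<open>
  \<open>exec c m t m'\<close>: started in memory \<open>m\<close>, the program \<open>c\<close> halts after time \<open>t\<close> in memory \<open>m'\<close>.
\<close>

inductive exec :: "com \<Rightarrow> memory \<Rightarrow> nat \<Rightarrow> memory \<Rightarrow> bool" where
  Skip: "exec Skip m 1 m"
| Store: "exec (Store a e1 e2) m
            (cost e1 m + cost e2 m + len (val e1 m) + len (val e2 m))
            (m(a := (m a)(val e1 m := val e2 m)))"
| Seq: "exec c1 m t1 m1 \<Longrightarrow> exec c2 m1 t2 m2 \<Longrightarrow> exec (Seq c1 c2) m (t1 + t2) m2"
| CondTrue: "val e m \<noteq> 0 \<Longrightarrow> exec c1 m t m' \<Longrightarrow>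
    exec (Cond e c1 c2) m (cost e m + len (val e m) + t) m'"
| CondFalse: "val e m = 0 \<Longrightarrow> exec c2 m t m' \<Longrightarrow>
    exec (Cond e c1 c2) m (cost e m + len (val e m) + t) m'"
| WhileFalse: "val e m = 0 \<Longrightarrow> exec (While e c) m (cost e m + len (val e m)) m"
| WhileTrue: "val e m \<noteq> 0 \<Longrightarrow> exec c m t1 m1 \<Longrightarrow> exec (While e c) m1 t2 m2 \<Longrightarrow>
    exec (While e c) m (cost e m + len (val e m) + t1 + t2) m2"

inductive_cases SkipE: "exec Skip m t m'"
inductive_cases StoreE: "exec (Store a e1 e2) m t m'"
inductive_cases SeqE: "exec (Seq c1 c2) m t m'"
inductive_cases CondE: "exec (Cond e c1 c2) m t m'"
inductive_cases WhileE: "exec (While e c) m t m'"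

lemma exec_deterministic:
  assumes "exec c m t m'" and "exec c m u m''"
  shows "t = u \<and> m' = m''"
  using assms
proof (induction arbitrary: u m'' rule: exec.induct)
  case (Skip m)
  then show ?case by (rule SkipE) simp
next
  case (Store a e1 e2 m)
  then show ?case by (rule StoreE) simp
next
  case (Seq c1 m t1 m1 c2 t2 m2)
  from Seq.prems show ?case by (rule SeqE) (force dest: Seq.IH)
next
  case (CondTrue e m c1 t m' c2)
  from CondTrue.prems show ?case by (rule CondE) (use CondTrue.hyps in \<open>force dest: CondTrue.IH\<close>)+
next
  case (CondFalse e m c2 t m' c1)
  from CondFalse.prems show ?case by (rule CondE) (use CondFalse.hyps in \<open>force dest: CondFalse.IH\<close>)+
next
  case (WhileFalse e m c)
  from WhileFalse.prems show ?case by (rule WhileE) (use WhileFalse.hyps in force)+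
next
  case (WhileTrue e m c t1 m1 t2 m2)
  from WhileTrue.prems show ?case
    by (rule WhileE) (use WhileTrue.hyps in \<open>force dest: WhileTrue.IH\<close>)+
qed


section \<open>Graphs and graph searches\<close>

definition simple_graph :: "'a set \<Rightarrow> 'a set set \<Rightarrow> bool" where
  "simple_graph V E \<longleftrightarrow> finite V \<and> (\<forall>e\<in>E. e \<subseteq> V \<and> card e = 2)"

definition nbrs :: "'a set set \<Rightarrow> 'a \<Rightarrow> 'a set" where
  "nbrs E v = {w. {v, w} \<in> E}"

definition mcs_ordering :: "'a set \<Rightarrow> 'a set set \<Rightarrow> 'a list \<Rightarrow> bool" where
  "mcs_ordering V E vs \<longleftrightarrow> distinct vs \<and> set vs = V \<and>
     (\<forall>i. 1 \<le> i \<and> i < length vs \<longrightarrow>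
        (\<forall>w \<in> V - set (take i vs).
           card (nbrs E w \<inter> set (take i vs)) \<le> card (nbrs E (vs ! i) \<inter> set (take i vs))))"

text \<open>
  \<open>bfs_state V E vs q\<close>: a breadth-first search can reach the situation in which \<open>vs\<close> lists the
  visited vertices in order of their first visit and \<open>q\<close> is the queue, front first.
\<close>

inductive bfs_state :: "'a set \<Rightarrow> 'a set set \<Rightarrow> 'a list \<Rightarrow> 'a list \<Rightarrow> bool"
  for V :: "'a set" and E :: "'a set set" where
  start: "s \<in> V \<Longrightarrow> bfs_state V E [s] [s]"
| dequeue: "bfs_state V E vs (u # q) \<Longrightarrow> distinct ws \<Longrightarrow> set ws = nbrs E u - set vs \<Longrightarrow>
    bfs_state V E (vs @ ws) (q @ ws)"

text \<open>
  A search is not restarted once its queue is empty; hence only a connected graph has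
  breadth-first orderings (of all its vertices).  Likewise for depth-first search below.
\<close>

definition bfs_ordering :: "'a set \<Rightarrow> 'a set set \<Rightarrow> 'a list \<Rightarrow> bool" where
  "bfs_ordering V E vs \<longleftrightarrow> bfs_state V E vs [] \<and> set vs = V"

text \<open>
  \<open>dfs_state V E vs st\<close>: a depth-first search can reach the situation in which \<open>vs\<close> lists the
  visited vertices in order of their first visit and \<open>st\<close> is the chain of discoverers from the
  current vertex back to the start vertex; \<open>st\<close> is empty when the search is over.
\<close>

inductive dfs_state :: "'a set \<Rightarrow> 'a set set \<Rightarrow> 'a list \<Rightarrow> 'a list \<Rightarrow> bool"
  for V :: "'a set" and E :: "'a set set" where
  start: "s \<in> V \<Longrightarrow> dfs_state V E [s] [s]"
| advance: "dfs_state V E vs (u # st) \<Longrightarrow> w \<in> nbrs E u - set vs \<Longrightarrow>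
    dfs_state V E (vs @ [w]) (w # u # st)"
| backtrack: "dfs_state V E vs (u # st) \<Longrightarrow> nbrs E u \<subseteq> set vs \<Longrightarrow> dfs_state V E vs st"

definition dfs_ordering :: "'a set \<Rightarrow> 'a set set \<Rightarrow> 'a list \<Rightarrow> bool" where
  "dfs_ordering V E vs \<longleftrightarrow> dfs_state V E vs [] \<and> set vs = V"

definition is_end_vertex :: "('a list \<Rightarrow> bool) \<Rightarrow> 'a \<Rightarrow> bool" where
  "is_end_vertex ord z \<longleftrightarrow> (\<exists>vs. ord vs \<and> vs \<noteq> [] \<and> last vs = z)"


section \<open>Deciding graph problems\<close>

text \<open>
  An input is a graph with vertex set \<open>{..<n}\<close> and a vertex \<open>z\<close>.  Array 0 starts with \<open>n\<close> and
  \<open>z\<close>, array 1 contains the adjacency matrix row by row, and the rest of the memory is 0.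
\<close>

definition input_memory :: "nat \<Rightarrow> nat set set \<Rightarrow> nat \<Rightarrow> memory" where
  "input_memory n E z = (\<lambda>a i.
     if a = 0 \<and> i = 0 then n
     else if a = 0 \<and> i = 1 then z
     else if a = 1 \<and> i < n * n \<and> {i div n, i mod n} \<in> E then 1
     else 0)"

text \<open>
  The answer is read off cell 0 of array 0: 1 for yes, 0 for no.
\<close>

definition decides_in_time ::
  "com \<Rightarrow> (nat set \<Rightarrow> nat set set \<Rightarrow> nat \<Rightarrow> bool) \<Rightarrow> (nat \<Rightarrow> nat) \<Rightarrow> bool" where
  "decides_in_time P Q T \<longleftrightarrow>
     (\<forall>n E z. simple_graph {..<n} E \<and> z < n \<longrightarrow>
        (\<exists>t m. exec P (input_memory n E z) t m \<and> t \<le> T n \<and>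
               m 0 0 = (if Q {..<n} E z then 1 else 0)))"

definition solvable_in_exp2_poly_time :: "(nat set \<Rightarrow> nat set set \<Rightarrow> nat \<Rightarrow> bool) \<Rightarrow> bool" where
  "solvable_in_exp2_poly_time Q \<longleftrightarrow>
     (\<exists>P T k. decides_in_time P Q T \<and> (\<lambda>n. real (T n)) \<in> O(\<lambda>n. 2 ^ n * real n ^ k))"

end

(*
  The three searches are decided by dynamic programming over vertex sets.

  MCS: S is the vertex set of a prefix of an MCS ordering iff it is empty or some w in S has the
  most neighbours in S - {w} among all vertices outside S - {w}, where S - {w} is again such a set.
  The vertex z is an end vertex iff V - {z} is the set of a prefix.

  DFS: z is an end vertex iff the graph is connected and some path that ends in z contains all
  neighbours of z (when z is visited last, its neighbours are on the stack; conversely, a search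
  that follows the path and at each of its vertices first explores all components not containing
  z has only z left in the end).  Paths are found by the dynamic program for Hamiltonian paths.

  BFS: the pairs (T, p), where T is the set visited before p, form chains: (S, q) is followed by
  (T, p) if p is adjacent to q and not in T, and T lies between the set visited by processing S
  and the set visited by processing S and q.  Here S and T lie between consecutive distance
  layers, which makes the number of candidate pairs (S, T) at most n * 2^n instead of 3^n.

  Running times: programs are written in a language of arithmetic terms with sums over {..<n} and
  {..<2^n}.  The values of a term are at most 2^(c n) for a constant c, so a term or loop takes
  time polynomial in n except for a factor 2^n for every nested sum or loop over {..<2^n}.
*)

theory Submission
  imports Defs "HOL-Library.Nat_Bijection"
begin

section \<open>Terms with bounded sums and their compilation\<close>

text \<open>A queue processes vertices in the order in which they were visited. The vertices
  processed before \<open>q\<close> are therefore exactly those visited before \<open>q\<close>, and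
  the same set \<open>S\<close> is both the first component of the pair \<open>(S, q)\<close> and
  the set whose neighbours have been visited when \<open>q\<close> comes to the front. Hence BFS
  needs only sets, no orders. A step of a chain still involves two sets, while the time bound leaves
  room for one loop over subsets. If \<open>L i\<close> is the set of vertices at distance less than
  \<open>i\<close>, then \<open>S\<close> lies inside \<open>L (i + 1)\<close> and \<open>T\<close>
  contains it, so \<open>S - L i\<close> and \<open>T - L (i + 1)\<close> are disjoint and their
  union, a single set, determines both. The logarithmic cost does not interfere with counting steps:
  every number handled by a term or loop is at most 2 ^ (n * D) with \<open>D\<close> depending on
  the program text alone, so its length is at most n * D + 1 and an elementary action costs a
  constant multiple of that. What remains to be controlled is the nesting of loops over subsets, a
  purely syntactic matter.\<close>

definition halts :: "com \<Rightarrow> memory \<Rightarrow> nat \<Rightarrow> (memory \<Rightarrow> bool) \<Rightarrow> bool" where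
  "halts c m T Q \<longleftrightarrow> (\<exists>t m'. exec c m t m' \<and> t \<le> T \<and> Q m')"

lemma halts_mono:
  assumes "halts c m T Q" and "T \<le> T'" and "\<And>m'. Q m' \<Longrightarrow> Q' m'"
  shows "halts c m T' Q'"
  using assms unfolding halts_def by (meson le_trans)

lemma halts_Store:
  assumes "Q (m(a := (m a)(val e1 m := val e2 m)))"
    and "cost e1 m + cost e2 m + len (val e1 m) + len (val e2 m) \<le> T"
  shows "halts (Store a e1 e2) m T Q"
  using assms exec.Store unfolding halts_def by blast

lemma halts_Seq:
  assumes "halts c1 m X (\<lambda>m1. halts c2 m1 Y Q)" and "X + Y \<le> T"
  shows "halts (Seq c1 c2) m T Q"
proof -
  obtain t1 m1 t2 m2 where "exec c1 m t1 m1" "t1 \<le> X" "exec c2 m1 t2 m2" "t2 \<le> Y" "Q m2"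
    using assms(1) unfolding halts_def by blast
  then show ?thesis
    using assms(2) exec.Seq unfolding halts_def by (metis add_mono le_trans)
qed

lemma halts_While_count:
  assumes body: "\<And>i m. i < N \<Longrightarrow> I i m \<Longrightarrow> halts c m X (I (Suc i))"
    and test: "\<And>i m. i \<le> N \<Longrightarrow> I i m \<Longrightarrow> (val e m \<noteq> 0 \<longleftrightarrow> i < N)"
    and cost: "\<And>i m. i \<le> N \<Longrightarrow> I i m \<Longrightarrow> cost e m + len (val e m) \<le> Y"
    and init: "I 0 m" and T: "N * (X + Y) + Y \<le> T"
  shows "halts (While e c) m T (I N)"
proof -
  \<comment> \<open>Induction on the number \<open>k\<close> of rounds still to come; the index
    \<open>N - k\<close> of the invariant rises as \<open>k\<close> falls.\<close>
  have "halts (While e c) m (k * (X + Y) + Y) (I N)" if "I (N - k) m" "k \<le> N" for k m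
    using that
  proof (induction k arbitrary: m)
    case 0
    then have "val e m = 0" "cost e m + len (val e m) \<le> Y" using test cost by auto
    then show ?case
      using 0 exec.WhileFalse[of e m c] unfolding halts_def by (auto intro!: exI)
  next
    case (Suc k)
    have v: "val e m \<noteq> 0" "cost e m + len (val e m) \<le> Y"
      using test[OF _ Suc.prems(1)] cost[OF _ Suc.prems(1)] Suc.prems(2) by auto
    have s: "Suc (N - Suc k) = N - k" using Suc.prems(2) by simp
    have "halts c m X (I (N - k))"
      using body[OF _ Suc.prems(1)] Suc.prems(2) s by simp
    then obtain t1 m1 where 1: "exec c m t1 m1" "t1 \<le> X" "I (N - k) m1"
      unfolding halts_def by blast
    then obtain t2 m2 where 2: "exec (While e c) m1 t2 m2" "t2 \<le> k * (X + Y) + Y" "I N m2"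
      using Suc.IH Suc.prems(2) unfolding halts_def by (meson Suc_leD)
    have "cost e m + len (val e m) + t1 + t2 \<le> Suc k * (X + Y) + Y"
      using v(2) 1(2) 2(2) by simp
    then show ?case using exec.WhileTrue[OF v(1) 1(1) 2(1)] 2(3) unfolding halts_def by blast
  qed
  from this[of N m] show ?thesis using init T by (auto intro: halts_mono)
qed

text \<open>\<open>Sum b v t\<close> sums over \<open>{..<2 ^ n}\<close> if \<open>b\<close> holds and over \<open>{..<n}\<close> otherwise; likewise for
  the loops \<open>For b v p\<close>.  Bound variables are numbered by nesting depth.

  Arrays 0 and 1 hold the input, array 2 the powers of 2, array 3 the evaluation stack, array 4
  the values of bound variables; arrays from 5 on are tables of bits.\<close>

datatype tm =
    Num nat
  | Var nat
  | Get nat tm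
  | Op binop tm tm
  | Sum bool nat tm

datatype stm =
    Asg nat tm tm
  | For bool nat stm
  | Then stm stm

definition bound :: "bool \<Rightarrow> memory \<Rightarrow> nat" where
  "bound b m = (if b then m 2 (m 0 0) else m 0 0)"

fun tval :: "tm \<Rightarrow> (nat \<Rightarrow> nat) \<Rightarrow> memory \<Rightarrow> nat" where
  "tval (Num k) \<rho> m = k"
| "tval (Var v) \<rho> m = \<rho> v"
| "tval (Get a t) \<rho> m = m a (tval t \<rho> m)"
| "tval (Op f s t) \<rho> m = apply_binop f (tval s \<rho> m) (tval t \<rho> m)"
| "tval (Sum b v t) \<rho> m = (\<Sum>i<bound b m. tval t (\<rho>(v := i)) m)"

fun run :: "stm \<Rightarrow> (nat \<Rightarrow> nat) \<Rightarrow> memory \<Rightarrow> memory" where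
  "run (Asg a s t) \<rho> m = m(a := (m a)(tval s \<rho> m := of_bool (tval t \<rho> m \<noteq> 0)))"
| "run (For b v p) \<rho> m = fold (\<lambda>i. run p (\<rho>(v := i))) [0..<bound b m] m"
| "run (Then p q) \<rho> m = run q \<rho> (run p \<rho> m)"

abbreviation cell :: "nat \<Rightarrow> nat \<Rightarrow> expr" where
  "cell a i \<equiv> Load a (Const i)"

fun bound_expr :: "bool \<Rightarrow> expr" where
  "bound_expr False = cell 0 0"
| "bound_expr True = Load 2 (cell 0 0)"

definition incr :: "nat \<Rightarrow> com" where
  "incr v = Store 4 (Const v) (Binop Plus (cell 4 v) (Const 1))"

definition count_loop :: "bool \<Rightarrow> nat \<Rightarrow> com \<Rightarrow> com" where
  "count_loop b v c = Seq (Store 4 (Const v) (Const 0))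
     (While (Binop Less (cell 4 v) (bound_expr b)) (Seq c (incr v)))"

fun compile_tm :: "nat \<Rightarrow> tm \<Rightarrow> com" where
  "compile_tm k (Num j) = Store 3 (Const k) (Const j)"
| "compile_tm k (Var v) = Store 3 (Const k) (cell 4 v)"
| "compile_tm k (Get a t) = Seq (compile_tm k t) (Store 3 (Const k) (Load a (cell 3 k)))"
| "compile_tm k (Op f s t) = Seq (compile_tm k s) (Seq (compile_tm (Suc k) t)
     (Store 3 (Const k) (Binop f (cell 3 k) (cell 3 (Suc k)))))"
| "compile_tm k (Sum b v t) = Seq (Store 3 (Const k) (Const 0)) (count_loop b v
     (Seq (compile_tm (Suc k) t)
        (Store 3 (Const k) (Binop Plus (cell 3 k) (cell 3 (Suc k))))))"

fun compile_stm :: "stm \<Rightarrow> com" where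
  "compile_stm (Asg a s t) = Seq (compile_tm 0 s) (Seq (compile_tm 1 t)
     (Store a (cell 3 0) (Binop Less (Const 0) (cell 3 1))))"
| "compile_stm (For b v p) = count_loop b v (compile_stm p)"
| "compile_stm (Then p q) = Seq (compile_stm p) (compile_stm q)"

text \<open>Constants stop at 2 because they must stay below 2 ^ n even for n = 1. Arrays 3 and 4
  may not be read since \<open>agree\<close> leaves their contents partly open. With
  \<open>v = d\<close> the number of a variable is its nesting depth, so an inner sum cannot
  overwrite the counter of an enclosing one.\<close>

fun wf_tm :: "nat \<Rightarrow> tm \<Rightarrow> bool" where
  "wf_tm d (Num k) \<longleftrightarrow> k \<le> 2"
| "wf_tm d (Var v) \<longleftrightarrow> v < d"
| "wf_tm d (Get a t) \<longleftrightarrow> a \<noteq> 3 \<and> a \<noteq> 4 \<and> wf_tm d t"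
| "wf_tm d (Op f s t) \<longleftrightarrow> wf_tm d s \<and> wf_tm d t"
| "wf_tm d (Sum b v t) \<longleftrightarrow> v = d \<and> wf_tm (Suc d) t"

fun wf_stm :: "nat \<Rightarrow> stm \<Rightarrow> bool" where
  "wf_stm d (Asg a s t) \<longleftrightarrow> 5 \<le> a \<and> wf_tm d s \<and> wf_tm d t"
| "wf_stm d (For b v p) \<longleftrightarrow> v = d \<and> wf_stm (Suc d) p"
| "wf_stm d (Then p q) \<longleftrightarrow> wf_stm d p \<and> wf_stm d q"

text \<open>The exponent in the bound 2 ^ (n * size) on values: multiplication adds exponents, and
  summing at most 2 ^ n values adds one. \<open>Sum\<close> adds 2 because below it the stack
  position and the nesting depth both grow by one, and \<open>k + d + tm_size t \<le> D\<close> has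
  to persist.\<close>

fun tm_size :: "tm \<Rightarrow> nat" where
  "tm_size (Num k) = 1"
| "tm_size (Var v) = 1"
| "tm_size (Get a t) = Suc (tm_size t)"
| "tm_size (Op f s t) = tm_size s + tm_size t"
| "tm_size (Sum b v t) = tm_size t + 2"

fun stm_size :: "stm \<Rightarrow> nat" where
  "stm_size (Asg a s t) = Suc (tm_size s + tm_size t)"
| "stm_size (For b v p) = Suc (stm_size p)"
| "stm_size (Then p q) = stm_size p + stm_size q"

abbreviation range_size :: "bool \<Rightarrow> nat \<Rightarrow> nat" where
  "range_size b n \<equiv> (if b then 2 ^ n else n)"

text \<open>Time in units of 40 * B, where \<open>B\<close> bounds the lengths of all numbers that
  occur. A single store fits into one unit, and so do the test and the increment of one round of a
  loop; the additive constants are generous.\<close>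

fun tm_steps :: "nat \<Rightarrow> tm \<Rightarrow> nat" where
  "tm_steps n (Num k) = 1"
| "tm_steps n (Var v) = 1"
| "tm_steps n (Get a t) = tm_steps n t + 1"
| "tm_steps n (Op f s t) = tm_steps n s + tm_steps n t + 1"
| "tm_steps n (Sum b v t) = range_size b n * (tm_steps n t + 3) + 3"

fun stm_steps :: "nat \<Rightarrow> stm \<Rightarrow> nat" where
  "stm_steps n (Asg a s t) = tm_steps n s + tm_steps n t + 1"
| "stm_steps n (For b v p) = range_size b n * (stm_steps n p + 2) + 2"
| "stm_steps n (Then p q) = stm_steps n p + stm_steps n q"

text \<open>The machine memory \<open>m\<close> simulates the abstract memory \<open>\<mu>\<close>.
  The stack is left free, and of the counters only those of the \<open>d\<close> enclosing loops are
  fixed, so compiled code may use all deeper cells as scratch space.\<close>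

definition agree :: "nat \<Rightarrow> (nat \<Rightarrow> nat) \<Rightarrow> memory \<Rightarrow> memory \<Rightarrow> bool" where
  "agree d \<rho> m \<mu> \<longleftrightarrow> (\<forall>a. a \<noteq> 3 \<longrightarrow> a \<noteq> 4 \<longrightarrow> m a = \<mu> a) \<and> (\<forall>i<d. m 4 i = \<rho> i)"

definition admissible :: "nat \<Rightarrow> memory \<Rightarrow> bool" where
  "admissible n \<mu> \<longleftrightarrow> 0 < n \<and> \<mu> 0 0 = n \<and> \<mu> 2 n = 2 ^ n \<and>
     (\<forall>a i. a \<noteq> 3 \<longrightarrow> a \<noteq> 4 \<longrightarrow> \<mu> a i \<le> 2 ^ n)"

section \<open>Bounds on the values of terms and on their binary lengths\<close>

lemma bound_admissible: "admissible n \<mu> \<Longrightarrow> bound b \<mu> = range_size b n"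
  by (auto simp: admissible_def bound_def)

lemma range_size_le: "range_size b n \<le> 2 ^ n"
  by (simp add: less_imp_le)

lemma add_le_mult_nat: "2 \<le> a \<Longrightarrow> 2 \<le> b \<Longrightarrow> a + b \<le> a * (b::nat)"
  by (metis add_le_mono mult.commute mult_2 mult_le_mono1 mult_le_mono2 nat_le_linear order_trans)

lemma tm_size_pos: "0 < tm_size t"
  by (induction t) auto

text \<open>The lower bounds 2 give \<open>a + b \<le> a * b\<close>, so that the product covers
  addition as well and exponents simply add up.\<close>

lemma apply_binop_le:
  assumes "x \<le> a" "y \<le> b" "2 \<le> a" "2 \<le> (b::nat)"
  shows "apply_binop f x y \<le> a * b"
proof -
  have ab: "a + b \<le> a * b" using add_le_mult_nat assms by blast
  have d: "x div y \<le> a" using assms(1) div_le_dividend le_trans by blast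
  have m: "x mod y \<le> a" using assms(1) mod_less_eq_dividend le_trans by blast
  show ?thesis using ab assms d m mult_le_mono[OF assms(1,2)] by (cases f) auto
qed

lemma two_le_power: "0 < n \<Longrightarrow> 0 < s \<Longrightarrow> (2::nat) \<le> 2 ^ (n * s)"
  using power_increasing[of 1 "n * s" "2::nat"] by simp

lemma tval_le:
  assumes "admissible n \<mu>" "wf_tm d t" "\<forall>i<d. \<rho> i \<le> 2 ^ n"
  shows "tval t \<rho> \<mu> \<le> 2 ^ (n * tm_size t)"
  using assms(2,3)
proof (induction t arbitrary: d \<rho>)
  case (Num k)
  have "(2::nat) \<le> 2 ^ n" using assms(1) two_le_power[of n 1] by (simp add: admissible_def)
  then show ?case using Num by simp
next
  case (Get a t)
  then have "\<mu> a (tval t \<rho> \<mu>) \<le> 2 ^ n" using assms(1) by (simp add: admissible_def)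
  also have "\<dots> \<le> 2 ^ (n * Suc (tm_size t))" by (rule power_increasing) auto
  finally show ?case by simp
next
  case (Op f s t)
  have "0 < n" using assms(1) by (simp add: admissible_def)
  then show ?case
    using Op apply_binop_le[OF Op.IH(1) Op.IH(2), of d \<rho> d \<rho> f]
    by (simp add: two_le_power tm_size_pos add_mult_distrib2 power_add)
next
  case (Sum b v t)
  have "tval t (\<rho>(v := i)) \<mu> \<le> 2 ^ (n * tm_size t)" if "i < bound b \<mu>" for i
  proof -
    have "i \<le> 2 ^ n"
      using that range_size_le[of b n] bound_admissible[OF assms(1)] by simp
    then show ?thesis using Sum by (intro Sum.IH[of "Suc d"]) (auto simp: less_Suc_eq)
  qed
  then have "tval (Sum b v t) \<rho> \<mu> \<le> bound b \<mu> * 2 ^ (n * tm_size t)"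
    using sum_bounded_above[of "{..<bound b \<mu>}" "\<lambda>i. tval t (\<rho>(v := i)) \<mu>"] by auto
  also have "\<dots> \<le> 2 ^ n * 2 ^ (n * tm_size t)"
    using range_size_le[of b n] bound_admissible[OF assms(1)] by simp
  also have "\<dots> \<le> 2 ^ (n * tm_size (Sum b v t))"
    by (simp add: power_add[symmetric] del: power_add)
  finally show ?case .
qed simp

lemma len_le: "x \<le> 2 ^ k \<Longrightarrow> len x \<le> Suc k"
proof -
  assume "x \<le> 2 ^ k"
  then have "x < 2 ^ Suc k" by (simp add: le_less_trans)
  then show ?thesis by (simp add: len_def floorlog_leI)
qed

definition short_up_to :: "nat \<Rightarrow> nat \<Rightarrow> bool" where
  "short_up_to N B \<longleftrightarrow> (\<forall>x\<le>N. len x \<le> B)"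

lemma bound_expr_val_cost:
  assumes "short_up_to (2 ^ (n * D)) B" and "admissible n \<mu>" and "agree d \<rho> m \<mu>"
    and "0 < D"
  shows "cost (bound_expr b) m + len (val (bound_expr b) m) \<le> 7 * B"
    and "val (bound_expr b) m = range_size b n"
proof -
  have n: "0 < n" and m: "m 0 0 = n" "m 2 n = 2 ^ n"
    using assms(2,3) by (auto simp: admissible_def agree_def)
  have le: "n \<le> 2 ^ (n * D)" "2 ^ n \<le> (2::nat) ^ (n * D)"
  proof -
    show "2 ^ n \<le> (2::nat) ^ (n * D)" using assms(4) by (intro power_increasing) auto
    then show "n \<le> 2 ^ (n * D)" using less_exp[of n] by linarith
  qed
  have "len 0 \<le> B" "len n \<le> B" "len (2 ^ n) \<le> B" using assms(1) le by (auto simp: short_up_to_def)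
  then show "cost (bound_expr b) m + len (val (bound_expr b) m) \<le> 7 * B"
    using m by (cases b) auto
  show "val (bound_expr b) m = range_size b n" using m by (cases b) auto
qed

lemma agree_Suc:
  "agree (Suc d) \<rho> m \<mu> \<longleftrightarrow> agree d \<rho> m \<mu> \<and> m 4 d = \<rho> d"
  by (auto simp: agree_def less_Suc_eq)

lemma agree_upd: "agree d (\<rho>(d := i)) m \<mu> \<longleftrightarrow> agree d \<rho> m \<mu>"
  by (auto simp: agree_def)

section \<open>Correctness and running time of compiled terms and loops\<close>

text \<open>\<open>\<mu>s i\<close> is the abstract memory after \<open>i\<close> rounds: constant
  for a sum, changing for a loop of assignments, so one lemma serves both. The postcondition of the
  body describes the memory with the counter already raised; the increment itself is then accounted
  for here once and for all.\<close>

lemma halts_count_loop: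
  assumes short: "short_up_to (2 ^ (n * D)) B"
    and \<mu>: "admissible n \<mu>" and d: "d < D"
    and mu: "\<And>i. i \<le> range_size b n \<Longrightarrow> admissible n (\<mu>s i)"
    and I: "\<And>i m. i \<le> range_size b n \<Longrightarrow> I i m \<Longrightarrow> agree (Suc d) (\<rho>(d := i)) m (\<mu>s i)"
    and init: "I 0 (m(4 := (m 4)(d := 0)))"
    and body: "\<And>i m. i < range_size b n \<Longrightarrow> I i m \<Longrightarrow>
       halts c m X (\<lambda>m'. m' 4 d = i \<and> I (Suc i) (m'(4 := (m' 4)(d := Suc i))))"
    and T: "range_size b n * (X + 40 * B) + 40 * B \<le> T"
  shows "halts (count_loop b d c) m T (I (range_size b n))"
proof -
  let ?N = "range_size b n"
  have len: "len x \<le> B" if "x \<le> 2 ^ (n * D)" for x using short that by (simp add: short_up_to_def)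
  have n: "0 < n" using \<mu> by (simp add: admissible_def)
  have D: "D < 2 ^ (n * D)"
    using less_exp[of "n * D"] n by (metis le_less_trans mult_le_mono1 nat_mult_1 Suc_leI One_nat_def)
  have "2 ^ n \<le> (2::nat) ^ (n * D)" using d by (intro power_increasing) auto
  then have N: "?N \<le> 2 ^ (n * D)" using range_size_le[of b n] by linarith
  have l: "len 0 \<le> B" "len 1 \<le> B" "len d \<le> B" using d D len by auto
  have i: "len i \<le> B" if "i \<le> ?N" for i using that N len le_trans by blast
  have e: "cost (bound_expr b) m + len (val (bound_expr b) m) \<le> 7 * B"
    "val (bound_expr b) m = ?N" if "i \<le> ?N" "I i m" for i m
    using bound_expr_val_cost[OF short mu[OF that(1)] I[OF that]] d by auto
  have "halts (While (Binop Less (cell 4 d) (bound_expr b)) (Seq c (incr d)))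
     (m(4 := (m 4)(d := 0))) (?N * (X + 13 * B + 20 * B) + 20 * B) (I ?N)"
  proof (rule halts_While_count[where I = I, OF _ _ _ init order_refl])
    fix i m assume im: "i < ?N" "I i m"
    show "halts (Seq c (incr d)) m (X + 13 * B) (I (Suc i))"
    proof (rule halts_Seq[OF halts_mono[OF body[OF im] order_refl]])
      fix m' assume "m' 4 d = i \<and> I (Suc i) (m'(4 := (m' 4)(d := Suc i)))"
      then show "halts (incr d) m' (13 * B) (I (Suc i))"
        using l i[of i] i[of "Suc i"] im unfolding incr_def by (intro halts_Store) auto
    qed simp
  next
    fix i m assume im: "i \<le> ?N" "I i m"
    have md: "m 4 d = i" using I[OF im] by (simp add: agree_def)
    show "(val (Binop Less (cell 4 d) (bound_expr b)) m \<noteq> 0) = (i < ?N)"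
      using md e[OF im] by simp
    show "cost (Binop Less (cell 4 d) (bound_expr b)) m
        + len (val (Binop Less (cell 4 d) (bound_expr b)) m) \<le> 20 * B"
      using md e[OF im] l i[OF im(1)] by auto
  qed
  then show ?thesis
    unfolding count_loop_def
  proof (intro halts_Seq[where X = "4 * B"] halts_Store)
    show "4 * B + (?N * (X + 13 * B + 20 * B) + 20 * B) \<le> T"
    proof -
      have "?N * (X + 13 * B + 20 * B) \<le> ?N * (X + 40 * B)" by simp
      then show ?thesis using T by linarith
    qed
  qed (use l in auto)
qed

lemma len_tval:
  assumes "short_up_to (2 ^ (n * D)) B" and "admissible n \<mu>"
    and "wf_tm d t" and "\<forall>i<d. \<rho> i \<le> 2 ^ n" and "tm_size t \<le> D"
  shows "len (tval t \<rho> \<mu>) \<le> B"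
proof -
  have "tval t \<rho> \<mu> \<le> 2 ^ (n * tm_size t)" using tval_le assms by blast
  also have "\<dots> \<le> 2 ^ (n * D)" using assms(5) by (intro power_increasing) auto
  finally show ?thesis using assms(1) by (simp add: short_up_to_def)
qed

text \<open>The cells below \<open>k\<close> have to survive because a left operand or a partial sum
  waits in the cell below while the next subterm is evaluated one position higher.\<close>

lemma halts_compile_tm:
  assumes short: "short_up_to (2 ^ (n * D)) B"
    and \<mu>: "admissible n \<mu>"
  shows "\<lbrakk>wf_tm d t; agree d \<rho> m \<mu>; \<forall>i<d. \<rho> i \<le> 2 ^ n; k + d + tm_size t \<le> D\<rbrakk> \<Longrightarrow>
    halts (compile_tm k t) m (tm_steps n t * (40 * B))
      (\<lambda>m'. agree d \<rho> m' \<mu> \<and> m' 3 k = tval t \<rho> \<mu> \<and> (\<forall>i<k. m' 3 i = m 3 i))"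
proof (induction t arbitrary: k d \<rho> m)
  have len: "len x \<le> B" if "x \<le> 2 ^ (n * D)" for x using short that by (simp add: short_up_to_def)
  have n: "0 < n" using \<mu> by (simp add: admissible_def)
  have D: "x \<le> 2 ^ (n * D)" if "x \<le> D" for x
    using less_exp[of "n * D"] n that
    by (metis le_less_trans less_imp_le mult_le_mono1 nat_mult_1 Suc_leI One_nat_def)
  have small: "len x \<le> B" if "x \<le> D" for x using D[OF that] len by blast
  note tv = len_tval[OF short \<mu>]
  {
    case (Num j)
    have "2 ^ (n * 1) \<le> (2::nat) ^ (n * D)" using Num by (intro power_increasing) auto
    then have "j \<le> 2 ^ (n * D)"
      using Num.prems(1) two_le_power[OF n, of 1] unfolding wf_tm.simps by linarith
    then have "len j \<le> B" "len k \<le> B" using len small Num by auto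
    then show ?case using Num by (auto simp: agree_def intro!: halts_Store)
  next
    case (Var v)
    then have "len v \<le> B" "len k \<le> B" "len (\<rho> v) \<le> B" "m 4 v = \<rho> v"
      using small tv[OF Var(1)] by (auto simp: agree_def)
    then show ?case using Var by (auto simp: agree_def intro!: halts_Store)
  next
    case (Get a t)
    then have t: "len (tval t \<rho> \<mu>) \<le> B" "len (tval (Get a t) \<rho> \<mu>) \<le> B" "len k \<le> B"
      using tv[of d t \<rho>] tv[OF Get.prems(1,3)] small by auto
    have a: "a \<noteq> 3" "a \<noteq> 4" using Get by auto
    show ?case
      unfolding compile_tm.simps
    proof (rule halts_Seq[OF halts_mono[OF Get.IH order_refl]])
      fix m1 assume 1: "agree d \<rho> m1 \<mu> \<and> m1 3 k = tval t \<rho> \<mu> \<and> (\<forall>i<k. m1 3 i = m 3 i)"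
      then have "m1 a = \<mu> a" using a by (simp add: agree_def)
      then show "halts (Store 3 (Const k) (Load a (cell 3 k))) m1 (40 * B)
         (\<lambda>m'. agree d \<rho> m' \<mu> \<and> m' 3 k = tval (Get a t) \<rho> \<mu> \<and> (\<forall>i<k. m' 3 i = m 3 i))"
        using 1 t by (intro halts_Store) (auto simp: agree_def)
    qed (use Get in auto)
  next
    case (Op f s t)
    have s: "len (tval s \<rho> \<mu>) \<le> B" "len (tval t \<rho> \<mu>) \<le> B"
        "len (apply_binop f (tval s \<rho> \<mu>) (tval t \<rho> \<mu>)) \<le> B" "len k \<le> B" "len (Suc k) \<le> B"
      using tv[of d s] tv[of d t] tv[of d "Op f s t"] Op.prems small tm_size_pos[of t] by auto
    have *: "k + d + tm_size s \<le> D" "Suc k + d + tm_size t \<le> D"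
      using Op.prems tm_size_pos[of s] by auto
    show ?case
      unfolding compile_tm.simps
    proof (rule halts_Seq[OF halts_mono[OF Op.IH(1) order_refl]])
      fix m1 assume 1: "agree d \<rho> m1 \<mu> \<and> m1 3 k = tval s \<rho> \<mu> \<and> (\<forall>i<k. m1 3 i = m 3 i)"
      show "halts (Seq (compile_tm (Suc k) t) (Store 3 (Const k) (Binop f (cell 3 k) (cell 3 (Suc k)))))
         m1 ((tm_steps n t + 1) * (40 * B))
         (\<lambda>m'. agree d \<rho> m' \<mu> \<and> m' 3 k = tval (Op f s t) \<rho> \<mu> \<and> (\<forall>i<k. m' 3 i = m 3 i))"
      proof (rule halts_Seq[OF halts_mono[OF Op.IH(2) order_refl]])
        fix m2 assume 2: "agree d \<rho> m2 \<mu> \<and> m2 3 (Suc k) = tval t \<rho> \<mu> \<and> (\<forall>i<Suc k. m2 3 i = m1 3 i)"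
        then show "halts (Store 3 (Const k) (Binop f (cell 3 k) (cell 3 (Suc k)))) m2 (40 * B)
           (\<lambda>m'. agree d \<rho> m' \<mu> \<and> m' 3 k = tval (Op f s t) \<rho> \<mu> \<and> (\<forall>i<k. m' 3 i = m 3 i))"
          using 1 s by (intro halts_Store) (auto simp: agree_def)
      qed (use Op.prems 1 * in \<open>auto simp: algebra_simps\<close>)
    qed (use Op.prems * in \<open>auto simp: algebra_simps\<close>)
  next
    case (Sum b v t)
    have v: "v = d" and wf: "wf_tm (Suc d) t" using Sum.prems by auto
    have dD: "d < D" using Sum.prems by simp
    let ?N = "range_size b n" and ?v = "\<lambda>i. tval t (\<rho>(d := i)) \<mu>"
    have N: "bound b \<mu> = ?N" using bound_admissible[OF \<mu>] .
    have rho: "\<forall>j<Suc d. (\<rho>(d := i)) j \<le> 2 ^ n" if "i \<le> ?N" for i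
      using that Sum.prems(3) range_size_le[of b n] by (auto simp: less_Suc_eq)
    \<comment> \<open>Partial sums are at most the full sum, whose size \<open>tval_le\<close>
      bounds.\<close>
    have part: "len (\<Sum>j<i. ?v j) \<le> B" if "i \<le> ?N" for i
    proof -
      have "(\<Sum>j<i. ?v j) \<le> (\<Sum>j<?N. ?v j)" using that by (intro sum_mono2) auto
      also have "\<dots> = tval (Sum b v t) \<rho> \<mu>" using N v by simp
      also have "\<dots> \<le> 2 ^ (n * tm_size (Sum b v t))" using tval_le[OF \<mu> Sum.prems(1,3)] .
      also have "\<dots> \<le> 2 ^ (n * D)" using Sum.prems(4) by (intro power_increasing mult_le_mono) auto
      finally show ?thesis by (rule len)
    qed
    have l: "len k \<le> B" "len (Suc k) \<le> B" "len 0 \<le> B" using small Sum.prems by auto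
    define I where "I = (\<lambda>i m'. agree (Suc d) (\<rho>(d := i)) m' \<mu> \<and> m' 3 k = (\<Sum>j<i. ?v j)
       \<and> (\<forall>i<k. m' 3 i = m 3 i))"
    let ?X = "tm_steps n t * (40 * B) + 40 * B"
    have "halts (count_loop b d (Seq (compile_tm (Suc k) t)
        (Store 3 (Const k) (Binop Plus (cell 3 k) (cell 3 (Suc k))))))
        (m(3 := (m 3)(k := 0))) (?N * (?X + 40 * B) + 40 * B) (I ?N)"
    proof (rule halts_count_loop[OF short \<mu> dD, where \<mu>s = "\<lambda>i. \<mu>" and X = ?X and I = I and \<rho> = \<rho>])
      show "I 0 ((m(3 := (m 3)(k := 0)))(4 := ((m(3 := (m 3)(k := 0))) 4)(d := 0)))"
        using Sum.prems(2) by (auto simp: I_def agree_def)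
    next
      fix i m1 assume i: "i < ?N" and 1: "I i m1"
      show "halts (Seq (compile_tm (Suc k) t) (Store 3 (Const k) (Binop Plus (cell 3 k) (cell 3 (Suc k)))))
         m1 ?X (\<lambda>m'. m' 4 d = i \<and> I (Suc i) (m'(4 := (m' 4)(d := Suc i))))"
      proof (rule halts_Seq[OF halts_mono[OF Sum.IH order_refl]])
        show "wf_tm (Suc d) t" using wf .
        show "agree (Suc d) (\<rho>(d := i)) m1 \<mu>" using 1 by (simp add: I_def)
        show "\<forall>j<Suc d. (\<rho>(d := i)) j \<le> 2 ^ n" using rho i by simp
        show "Suc k + Suc d + tm_size t \<le> D" using Sum.prems(4) by simp
        fix m2 assume 2: "agree (Suc d) (\<rho>(d := i)) m2 \<mu> \<and> m2 3 (Suc k) = ?v i \<and>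
           (\<forall>i<Suc k. m2 3 i = m1 3 i)"
        have "len (?v i) \<le> B" using Sum.prems(4) i by (intro tv[OF wf rho]) auto
        then show "halts (Store 3 (Const k) (Binop Plus (cell 3 k) (cell 3 (Suc k)))) m2 (40 * B)
           (\<lambda>m'. m' 4 d = i \<and> I (Suc i) (m'(4 := (m' 4)(d := Suc i))))"
          using 1 2 l part[of i] part[of "Suc i"] i
          by (intro halts_Store) (auto simp: I_def agree_def less_Suc_eq)
      qed simp
    qed (use \<mu> in \<open>auto simp: I_def\<close>)
    then have "halts (count_loop b d (Seq (compile_tm (Suc k) t)
        (Store 3 (Const k) (Binop Plus (cell 3 k) (cell 3 (Suc k))))))
        (m(3 := (m 3)(k := 0))) (?N * (?X + 40 * B) + 40 * B)
        (\<lambda>m'. agree d \<rho> m' \<mu> \<and> m' 3 k = tval (Sum b v t) \<rho> \<mu> \<and> (\<forall>i<k. m' 3 i = m 3 i))"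
      by (rule halts_mono) (auto simp: I_def agree_Suc agree_upd N v)
    then show ?case
      unfolding compile_tm.simps v
      by (intro halts_Seq[where X = "40 * B"] halts_Store)
        (use l in \<open>auto simp: algebra_simps\<close>)
  }
qed

lemma run_other: "wf_stm d p \<Longrightarrow> a < 5 \<Longrightarrow> run p \<rho> m a = m a"
proof (induction p arbitrary: d \<rho> m)
  case (For b v p)
  have "fold (\<lambda>i. run p (\<rho>(v := i))) is m a = m a" for "is"
    by (induction "is" arbitrary: m) (use For in auto)
  then show ?case by simp
qed auto

text \<open>Assignments write single bits, and only into arrays from 5 on; neither the bound 2 ^ n
  on entries nor the input and the powers of 2 can be destroyed.\<close>

lemma run_admissible:
  assumes "wf_stm d p" and "admissible n m"
  shows "admissible n (run p \<rho> m)"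
proof -
  have "\<forall>a i. a \<noteq> 3 \<longrightarrow> a \<noteq> 4 \<longrightarrow> run p \<rho> m a i \<le> 2 ^ n"
    if "\<forall>a i. a \<noteq> 3 \<longrightarrow> a \<noteq> 4 \<longrightarrow> m a i \<le> 2 ^ n" "wf_stm d p"
    using that
  proof (induction p arbitrary: d \<rho> m)
    case (For b v p)
    have "\<forall>a i. a \<noteq> 3 \<longrightarrow> a \<noteq> 4 \<longrightarrow> fold (\<lambda>i. run p (\<rho>(v := i))) is m a i \<le> 2 ^ n" for "is"
      using For.prems(1)
    proof (induction "is" arbitrary: m)
      case (Cons i "is")
      show ?case unfolding fold_Cons comp_apply
        by (rule Cons.IH, rule For.IH[of _ "Suc d"]) (use Cons.prems For.prems in auto)
    qed simp
    then show ?case by simp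
  next
    case (Then p q)
    show ?case unfolding run.simps
      by (rule Then.IH(2)[of _ d], rule Then.IH(1)[of _ d]) (use Then.prems in auto)
  qed (auto simp: Suc_leI)
  then show ?thesis
    using assms run_other[OF assms(1)] by (auto simp: admissible_def)
qed

lemma halts_compile_stm:
  assumes short: "short_up_to (2 ^ (n * D)) B"
  shows "\<lbrakk>wf_stm d p; admissible n \<mu>; agree d \<rho> m \<mu>; \<forall>i<d. \<rho> i \<le> 2 ^ n; d + stm_size p \<le> D\<rbrakk> \<Longrightarrow>
    halts (compile_stm p) m (stm_steps n p * (40 * B)) (\<lambda>m'. agree d \<rho> m' (run p \<rho> \<mu>))"
proof (induction p arbitrary: d \<rho> m \<mu>)
  case (Asg a s t)
  have len: "len x \<le> B" if "x \<le> 2 ^ (n * D)" for x using short that by (simp add: short_up_to_def)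
  have n: "0 < n" using Asg.prems by (simp add: admissible_def)
  have st: "len (tval s \<rho> \<mu>) \<le> B" "len (tval t \<rho> \<mu>) \<le> B"
    using Asg.prems len_tval[OF short Asg.prems(2), of d] by auto
  have one: "1 \<le> (2::nat) ^ (n * D)" by simp
  have l: "len 0 \<le> B" "len 1 \<le> B" using len[OF one] len[of 0] by auto
  show ?case
    unfolding compile_stm.simps
  proof (rule halts_Seq[OF halts_mono[OF halts_compile_tm[OF short] order_refl]])
    fix m1 assume 1: "agree d \<rho> m1 \<mu> \<and> m1 3 0 = tval s \<rho> \<mu> \<and> (\<forall>i<0. m1 3 i = m 3 i)"
    show "halts (Seq (compile_tm 1 t) (Store a (cell 3 0) (Binop Less (Const 0) (cell 3 1))))
       m1 ((tm_steps n t + 1) * (40 * B)) (\<lambda>m'. agree d \<rho> m' (run (Asg a s t) \<rho> \<mu>))"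
    proof (rule halts_Seq[OF halts_mono[OF halts_compile_tm[OF short] order_refl]])
      fix m2 assume 2: "agree d \<rho> m2 \<mu> \<and> m2 3 1 = tval t \<rho> \<mu> \<and> (\<forall>i<1. m2 3 i = m1 3 i)"
      then show "halts (Store a (cell 3 0) (Binop Less (Const 0) (cell 3 1))) m2 (40 * B)
          (\<lambda>m'. agree d \<rho> m' (run (Asg a s t) \<rho> \<mu>))"
        using 1 st l Asg.prems by (intro halts_Store) (auto simp: agree_def)
    qed (use Asg.prems 1 tm_size_pos[of s] in \<open>auto simp: algebra_simps\<close>)
  qed (use Asg.prems tm_size_pos[of s] in \<open>auto simp: algebra_simps\<close>)
next
  case (For b v p)
  have v: "v = d" using For.prems by simp
  let ?N = "range_size b n" and ?f = "\<lambda>i. run p (\<rho>(d := i))"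
  let ?\<mu> = "\<lambda>i. fold ?f [0..<i] \<mu>"
  have N: "bound b \<mu> = ?N" using bound_admissible[OF For.prems(2)] .
  have adm: "admissible n (?\<mu> i)" for i
    by (induction i) (use For.prems run_admissible[of "Suc d"] in auto)
  have "halts (count_loop b d (compile_stm p)) m (?N * (stm_steps n p * (40 * B) + 40 * B) + 40 * B)
     (\<lambda>m'. agree (Suc d) (\<rho>(d := ?N)) m' (?\<mu> ?N))"
  proof (rule halts_count_loop[OF short For.prems(2), where \<mu>s = ?\<mu> and \<rho> = \<rho>
        and I = "\<lambda>i m'. agree (Suc d) (\<rho>(d := i)) m' (?\<mu> i)"])
    fix i m' assume i: "i < ?N" "agree (Suc d) (\<rho>(d := i)) m' (?\<mu> i)"
    have "\<forall>j<Suc d. (\<rho>(d := i)) j \<le> 2 ^ n"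
      using i For.prems range_size_le[of b n] by (auto simp: less_Suc_eq)
    then have "halts (compile_stm p) m' (stm_steps n p * (40 * B))
       (\<lambda>m''. agree (Suc d) (\<rho>(d := i)) m'' (?f i (?\<mu> i)))"
      using i For.prems adm by (intro For.IH) (auto simp del: fun_upd_apply)
    then show "halts (compile_stm p) m' (stm_steps n p * (40 * B)) (\<lambda>m''. m'' 4 d = i \<and>
       agree (Suc d) (\<rho>(d := Suc i)) (m''(4 := (m'' 4)(d := Suc i))) (?\<mu> (Suc i)))"
      by (rule halts_mono) (auto simp: agree_def)
  qed (use For.prems adm in \<open>auto simp: agree_def\<close>)
  then show ?case
    unfolding compile_stm.simps v
    by (rule halts_mono) (auto simp: N agree_Suc agree_upd algebra_simps)
next
  case (Then p q)
  show ?case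
    unfolding compile_stm.simps
  proof (rule halts_Seq[OF halts_mono[OF Then.IH(1) order_refl]])
    fix m1 assume "agree d \<rho> m1 (run p \<rho> \<mu>)"
    then show "halts (compile_stm q) m1 (stm_steps n q * (40 * B))
       (\<lambda>m'. agree d \<rho> m' (run (Then p q) \<rho> \<mu>))"
      unfolding run.simps using Then.prems run_admissible by (intro Then.IH(2)) auto
  qed (use Then.prems in \<open>auto simp: algebra_simps\<close>)
qed

text \<open>The machine has no exponentiation, so the powers of 2 are produced by repeated doubling,
  with cell 0 of array 4 as counter.\<close>

definition prelude :: com where
  "prelude = Seq (Store 2 (Const 0) (Const 1)) (Seq (Store 4 (Const 0) (Const 0))
     (While (Binop Less (cell 4 0) (cell 0 0))
        (Seq (Store 2 (Binop Plus (cell 4 0) (Const 1))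
               (Binop Plus (Load 2 (cell 4 0)) (Load 2 (cell 4 0))))
             (incr 0))))"

definition start_memory :: "nat \<Rightarrow> nat set set \<Rightarrow> nat \<Rightarrow> memory" where
  "start_memory n E z = (input_memory n E z)(2 := (\<lambda>i. if i \<le> n then 2 ^ i else 0))"

lemma admissible_start: "z < n \<Longrightarrow> admissible n (start_memory n E z)"
  unfolding admissible_def start_memory_def
proof (intro conjI allI impI)
  fix a i :: nat
  assume "z < n"
  have "n < 2 ^ n" by (rule less_exp)
  moreover from this have "z < 2 ^ n" using \<open>z < n\<close> by linarith
  moreover have "i \<le> n \<Longrightarrow> (2::nat) ^ i \<le> 2 ^ n" by (rule power_increasing) auto
  ultimately show "((input_memory n E z)(2 := \<lambda>i. if i \<le> n then 2 ^ i else 0)) a i \<le> 2 ^ n"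
    using \<open>z < n\<close> by (auto simp: input_memory_def)
qed (auto simp: input_memory_def)

lemma halts_prelude:
  assumes "short_up_to (2 ^ n) B" and n: "0 < n"
  shows "halts prelude (input_memory n E z) ((n + 1) * (40 * B))
    (\<lambda>m. agree 0 \<rho> m (start_memory n E z))"
proof -
  let ?m = "input_memory n E z"
  define I where "I = (\<lambda>i m. m 4 0 = i \<and> m 2 = (\<lambda>j. if j \<le> i then 2 ^ j else 0) \<and>
     (\<forall>a. a \<noteq> 2 \<longrightarrow> a \<noteq> 3 \<longrightarrow> a \<noteq> 4 \<longrightarrow> m a = ?m a))"
  have len: "len x \<le> B" if "x \<le> 2 ^ n" for x using assms that by (simp add: short_up_to_def)
  have one: "1 \<le> (2::nat) ^ n" by simp
  have l: "len 0 \<le> B" "len 1 \<le> B" "len (Suc 0) \<le> B" using len[OF one] len[of 0] by auto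
  have i: "len i \<le> B" if "i \<le> n" for i using that less_exp[of n] len le_trans less_imp_le by blast
  have pw: "len (2 ^ i) \<le> B" if "i \<le> n" for i using that len by simp
  have m0: "m 0 0 = n" if "I i m" for i m using that by (simp add: I_def input_memory_def)
  let ?S = "?m(2 := (?m 2)(0 := 1))"
  let ?b = "Seq (Store 2 (Binop Plus (cell 4 0) (Const 1))
               (Binop Plus (Load 2 (cell 4 0)) (Load 2 (cell 4 0)))) (incr 0)"
  have "halts (While (Binop Less (cell 4 0) (cell 0 0)) ?b)
     (?S(4 := (?S 4)(0 := 0))) (n * (29 * B + 9 * B) + 9 * B) (I n)"
  proof (rule halts_While_count[where I = I, OF _ _ _ _ order_refl])
    fix i m assume im: "i < n" "I i m"
    have "halts (Store 2 (Binop Plus (cell 4 0) (Const 1))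
               (Binop Plus (Load 2 (cell 4 0)) (Load 2 (cell 4 0)))) m (20 * B)
        (\<lambda>m'. I (Suc i) (m'(4 := (m' 4)(0 := Suc i))) \<and> m' 4 0 = i)"
      using l i[of i] i[of "Suc i"] pw[of i] pw[of "Suc i"] im
      by (intro halts_Store) (auto simp: I_def fun_eq_iff mult_2)
    then show "halts ?b m (29 * B) (I (Suc i))"
    proof (rule halts_Seq[OF halts_mono[OF _ order_refl]])
      fix m' assume "I (Suc i) (m'(4 := (m' 4)(0 := Suc i))) \<and> m' 4 0 = i"
      then show "halts (incr 0) m' (9 * B) (I (Suc i))"
        using l i[of i] i[of "Suc i"] im unfolding incr_def by (intro halts_Store) auto
    qed simp
  next
    show "I 0 (?S(4 := (?S 4)(0 := 0)))"
      by (auto simp: I_def input_memory_def)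
  next
    fix i m assume im: "i \<le> n" "I i m"
    show "cost (Binop Less (cell 4 0) (cell 0 0)) m
        + len (val (Binop Less (cell 4 0) (cell 0 0)) m) \<le> 9 * B"
      using m0[OF im(2)] im l i[OF im(1)] i[of n] by (auto simp: I_def)
    show "(val (Binop Less (cell 4 0) (cell 0 0)) m \<noteq> 0) = (i < n)"
      using m0[OF im(2)] im by (auto simp: I_def)
  qed
  then have "halts (While (Binop Less (cell 4 0) (cell 0 0)) ?b)
     (?S(4 := (?S 4)(0 := 0))) (n * (40 * B) + 20 * B)
     (\<lambda>m. agree 0 \<rho> m (start_memory n E z))"
    by (rule halts_mono) (auto simp: I_def agree_def start_memory_def)
  then show ?thesis
    unfolding prelude_def
    by (intro halts_Seq[where X = "4 * B"] halts_Store) (use l in auto)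
qed

definition compile :: "stm \<Rightarrow> tm \<Rightarrow> com" where
  "compile p a = Seq prelude (Seq (compile_stm p) (Seq (compile_tm 0 a)
     (Store 0 (Const 0) (Binop Less (Const 0) (cell 3 0)))))"

lemma halts_compile:
  assumes "z < n" and p: "wf_stm 0 p" and a: "wf_tm 0 a"
    and D: "stm_size p \<le> D" "tm_size a \<le> D"
  shows "halts (compile p a) (input_memory n E z)
    ((n + stm_steps n p + tm_steps n a + 2) * (40 * (n * D + 1)))
    (\<lambda>m. m 0 0 = of_bool (tval a \<rho> (run p \<rho> (start_memory n E z)) \<noteq> 0))"
proof -
  let ?B = "n * D + 1" and ?m = "start_memory n E z"
  let ?m' = "run p \<rho> ?m"
  have n: "0 < n" and D0: "0 < D" using assms(1) D tm_size_pos[of a] by auto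
  have len: "len x \<le> ?B" if "x \<le> 2 ^ (n * D)" for x using len_le[OF that] by simp
  then have B: "short_up_to (2 ^ (n * D)) ?B" by (simp add: short_up_to_def)
  have "(2::nat) ^ n \<le> 2 ^ (n * D)" using D0 by (intro power_increasing) auto
  then have B': "short_up_to (2 ^ n) ?B" using len le_trans unfolding short_up_to_def by blast
  have adm: "admissible n ?m" "admissible n ?m'"
    using admissible_start assms(1) run_admissible p by auto
  have l: "len 0 \<le> ?B" "len 1 \<le> ?B" using len[of 0] len[of 1] by auto
  have v: "len (tval a \<rho> ?m') \<le> ?B" using len_tval[OF B adm(2) a] D by simp
  let ?U = "40 * ?B"
  show ?thesis unfolding compile_def
  proof (rule halts_Seq[OF halts_mono[OF halts_prelude[OF B' n] order_refl]])
    fix m1 assume 1: "agree 0 \<rho> m1 ?m"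
    show "halts (Seq (compile_stm p) (Seq (compile_tm 0 a)
       (Store 0 (Const 0) (Binop Less (Const 0) (cell 3 0))))) m1
       (stm_steps n p * ?U + (tm_steps n a * ?U + ?U))
       (\<lambda>m. m 0 0 = of_bool (tval a \<rho> ?m' \<noteq> 0))"
    proof (rule halts_Seq[OF halts_mono[OF halts_compile_stm[OF B p adm(1) 1] order_refl]])
      fix m2 assume 2: "agree 0 \<rho> m2 ?m'"
      show "halts (Seq (compile_tm 0 a) (Store 0 (Const 0) (Binop Less (Const 0) (cell 3 0)))) m2
         (tm_steps n a * ?U + ?U) (\<lambda>m. m 0 0 = of_bool (tval a \<rho> ?m' \<noteq> 0))"
      proof (rule halts_Seq[OF halts_mono[OF halts_compile_tm[OF B adm(2) a 2] order_refl]])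
        fix m3 assume "agree 0 \<rho> m3 ?m' \<and> m3 3 0 = tval a \<rho> ?m' \<and> (\<forall>i<0. m3 3 i = m2 3 i)"
        then show "halts (Store 0 (Const 0) (Binop Less (Const 0) (cell 3 0))) m3 ?U
          (\<lambda>m. m 0 0 = of_bool (tval a \<rho> ?m' \<noteq> 0))"
          using l v by (intro halts_Store) auto
      qed (use D in auto)
    qed (use D in auto)
  qed (simp add: algebra_simps)
qed

section \<open>Growth of step counts\<close>

text \<open>The nesting depth of sums over subsets, which is the exponent of 2 ^ n in the number of
  steps. Sums that stand side by side cost only a maximum.\<close>

fun tm_big :: "tm \<Rightarrow> nat" where
  "tm_big (Num k) = 0"
| "tm_big (Var v) = 0"
| "tm_big (Get a t) = tm_big t"
| "tm_big (Op f s t) = max (tm_big s) (tm_big t)"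
| "tm_big (Sum b v t) = of_bool b + tm_big t"

fun stm_big :: "stm \<Rightarrow> nat" where
  "stm_big (Asg a s t) = max (tm_big s) (tm_big t)"
| "stm_big (For b v p) = of_bool b + stm_big p"
| "stm_big (Then p q) = max (stm_big p) (stm_big q)"

text \<open>The value n = 0 is excluded because n ^ e vanishes there for positive \<open>e\<close>;
  the asymptotic statement does not see it.\<close>

definition exp_poly :: "nat \<Rightarrow> (nat \<Rightarrow> nat) \<Rightarrow> bool" where
  "exp_poly b f \<longleftrightarrow> (\<exists>C e. \<forall>n>0. f n \<le> C * ((2 ^ n) ^ b * n ^ e))"

lemma exp_poly_const: "exp_poly b (\<lambda>n. c)"
  unfolding exp_poly_def by (rule exI[of _ c], rule exI[of _ 0]) auto

lemma exp_poly_id: "exp_poly b (\<lambda>n. n)"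
  unfolding exp_poly_def by (rule exI[of _ 1], rule exI[of _ 1]) auto

lemma exp_poly_add:
  assumes "exp_poly b f" "exp_poly c g"
  shows "exp_poly (max b c) (\<lambda>n. f n + g n)"
proof -
  obtain C e C' e' where f: "\<forall>n>0. f n \<le> C * ((2 ^ n) ^ b * n ^ e)"
    and g: "\<forall>n>0. g n \<le> C' * ((2 ^ n) ^ c * n ^ e')"
    using assms unfolding exp_poly_def by blast
  have "f n + g n \<le> (C + C') * ((2 ^ n) ^ max b c * n ^ (e + e'))" if "n > 0" for n
  proof -
    have "f n \<le> C * ((2 ^ n) ^ max b c * n ^ (e + e'))"
      using f that by (intro order_trans[OF f[rule_format, OF that]] mult_le_mono power_increasing) auto
    moreover have "g n \<le> C' * ((2 ^ n) ^ max b c * n ^ (e + e'))"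
      using g that by (intro order_trans[OF g[rule_format, OF that]] mult_le_mono power_increasing) auto
    ultimately show ?thesis by (simp add: add_mult_distrib)
  qed
  then show ?thesis unfolding exp_poly_def by blast
qed

lemma exp_poly_mult:
  assumes "exp_poly b f" "exp_poly c g"
  shows "exp_poly (b + c) (\<lambda>n. f n * g n)"
proof -
  obtain C e C' e' where f: "\<forall>n>0. f n \<le> C * ((2 ^ n) ^ b * n ^ e)"
    and g: "\<forall>n>0. g n \<le> C' * ((2 ^ n) ^ c * n ^ e')"
    using assms unfolding exp_poly_def by blast
  have "f n * g n \<le> (C * C') * ((2 ^ n) ^ (b + c) * n ^ (e + e'))" if "n > 0" for n
    using mult_le_mono[OF f[rule_format, OF that] g[rule_format, OF that]]
    by (simp add: power_add mult_ac)
  then show ?thesis unfolding exp_poly_def by blast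
qed

lemma exp_poly_range: "exp_poly (of_bool b) (range_size b)"
proof (cases b)
  case True
  have "\<forall>n>0. 2 ^ n \<le> 1 * (((2::nat) ^ n) ^ 1 * n ^ 0)" by simp
  then have "exp_poly 1 (\<lambda>n. 2 ^ n)" unfolding exp_poly_def by blast
  then show ?thesis using True by simp
next
  case False
  then show ?thesis using exp_poly_id[of 0] by simp
qed

lemma exp_poly_add_const: "exp_poly b f \<Longrightarrow> exp_poly b (\<lambda>n. f n + c)"
  using exp_poly_add[OF _ exp_poly_const[of 0], of b f c] by simp

lemma exp_poly_loop:
  "exp_poly c f \<Longrightarrow> exp_poly (of_bool b + c) (\<lambda>n. range_size b n * (f n + k) + j)"
  by (rule exp_poly_add_const[OF exp_poly_mult[OF exp_poly_range exp_poly_add_const]])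

lemma exp_poly_tm_steps: "exp_poly (tm_big t) (\<lambda>n. tm_steps n t)"
proof (induction t)
  case (Op f s t)
  then show ?case
    unfolding tm_steps.simps tm_big.simps by (rule exp_poly_add_const[OF exp_poly_add])
next
  case (Sum b v t)
  then show ?case
    unfolding tm_steps.simps tm_big.simps by (rule exp_poly_loop)
next
  case (Get a t)
  then show ?case
    unfolding tm_steps.simps tm_big.simps by (rule exp_poly_add_const)
qed (simp_all add: exp_poly_const)

lemma exp_poly_stm_steps: "exp_poly (stm_big p) (\<lambda>n. stm_steps n p)"
proof (induction p)
  case (Asg a s t)
  then show ?case
    unfolding stm_steps.simps stm_big.simps
    by (rule exp_poly_add_const[OF exp_poly_add[OF exp_poly_tm_steps exp_poly_tm_steps]])
next
  case (For b v p)
  then show ?case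
    unfolding stm_steps.simps stm_big.simps by (rule exp_poly_loop)
qed (simp add: exp_poly_add)

lemma exp_poly_bigo:
  assumes "exp_poly 1 T"
  shows "\<exists>k. (\<lambda>n. real (T n)) \<in> O(\<lambda>n. 2 ^ n * real n ^ k)"
proof -
  obtain C e where T: "\<forall>n>0. T n \<le> C * ((2 ^ n) ^ 1 * n ^ e)"
    using assms unfolding exp_poly_def by blast
  have "(\<lambda>n. real (T n)) \<in> O(\<lambda>n. 2 ^ n * real n ^ e)"
  proof (rule bigoI[of _ "real C"], rule eventually_mono[OF eventually_gt_at_top[of 0]])
    fix n :: nat assume "0 < n"
    then have "real (T n) \<le> real (C * ((2 ^ n) ^ 1 * n ^ e))" using T by (intro of_nat_mono) auto
    then show "norm (real (T n)) \<le> real C * norm (2 ^ n * real n ^ e)" by simp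
  qed
  then show ?thesis by blast
qed

text \<open>The interface to the three searches: running time is reduced to the two syntactic
  conditions on nesting depth, correctness to the abstract semantics \<open>run\<close> and
  \<open>tval\<close>.\<close>

theorem solvable_compile:
  assumes p: "wf_stm 0 p" "stm_big p \<le> 1" and a: "wf_tm 0 a" "tm_big a \<le> 1"
    and Q: "\<And>n E z. simple_graph {..<n} E \<Longrightarrow> z < n \<Longrightarrow>
      tval a \<rho> (run p \<rho> (start_memory n E z)) \<noteq> 0 \<longleftrightarrow> Q {..<n} E z"
  shows "solvable_in_exp2_poly_time Q"
proof -
  let ?D = "stm_size p + tm_size a"
  let ?T = "\<lambda>n. (n + stm_steps n p + tm_steps n a + 2) * (40 * (n * ?D + 1))"
  have decides: "decides_in_time (compile p a) Q ?T"
    unfolding decides_in_time_def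
  proof (intro allI impI, elim conjE)
    fix n z :: nat and E assume G: "simple_graph {..<n} E" "z < n"
    from halts_compile[OF G(2) p(1) a(1), of ?D E \<rho>]
    have "halts (compile p a) (input_memory n E z) (?T n) (\<lambda>m. m 0 0 = (if Q {..<n} E z then 1 else 0))"
      unfolding Q[OF G] of_bool_def by simp
    then show "\<exists>t m. exec (compile p a) (input_memory n E z) t m \<and> t \<le> ?T n \<and>
       m 0 0 = (if Q {..<n} E z then 1 else 0)"
      unfolding halts_def .
  qed
  have "exp_poly 1 ?T"
  proof -
    have m: "exp_poly 1 f" if "exp_poly b f" "b \<le> 1" for f b
      using exp_poly_add[OF that(1) exp_poly_const[of 1 0]] that(2) by (simp add: max_def split: if_splits)
    have "exp_poly (max (max 1 1) 1) (\<lambda>n. n + stm_steps n p + tm_steps n a + 2)"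
      by (rule exp_poly_add_const[OF exp_poly_add[OF exp_poly_add[OF exp_poly_id
        m[OF exp_poly_stm_steps p(2)]] m[OF exp_poly_tm_steps a(2)]]])
    moreover have "exp_poly (0 + 0) (\<lambda>n. 40 * (n * ?D + 1))"
      by (rule exp_poly_mult[OF exp_poly_const exp_poly_add_const[OF
        exp_poly_mult[OF exp_poly_id exp_poly_const, of 0 0, unfolded add_0_right]]])
    ultimately have "exp_poly (max (max 1 1) 1 + (0 + 0)) ?T" by (rule exp_poly_mult)
    then show ?thesis unfolding add_0_right max.idem .
  qed
  from exp_poly_bigo[OF this] obtain k where "(\<lambda>n. real (?T n)) \<in> O(\<lambda>n. 2 ^ n * real n ^ k)" ..
  with decides show ?thesis
    unfolding solvable_in_exp2_poly_time_def by (intro exI[of _ "compile p a"] exI[of _ ?T] exI[of _ k] conjI)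
qed

section \<open>Loop invariants and logical formulas as arithmetic terms\<close>

lemma run_For:
  assumes "bound b m = N" and "I 0 m"
    and "\<And>i m. i < N \<Longrightarrow> I i m \<Longrightarrow> I (Suc i) (run p (\<rho>(v := i)) m)"
  shows "I N (run (For b v p) \<rho> m)"
proof -
  have "I k (fold (\<lambda>i. run p (\<rho>(v := i))) [0..<k] m)" if "k \<le> N" for k
    using that by (induction k) (use assms in auto)
  then show ?thesis using assms(1) by simp
qed

definition inputs :: "nat \<Rightarrow> nat set set \<Rightarrow> nat \<Rightarrow> memory \<Rightarrow> bool" where
  "inputs n E z m \<longleftrightarrow> (\<forall>a<5. m a = start_memory n E z a)"

lemma inputs_start: "inputs n E z (start_memory n E z)"
  by (simp add: inputs_def)

lemma inputs_run: "inputs n E z m \<Longrightarrow> wf_stm d p \<Longrightarrow> inputs n E z (run p \<rho> m)"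
  by (simp add: inputs_def run_other)

lemma inputs_upd: "inputs n E z m \<Longrightarrow> 5 \<le> a \<Longrightarrow> inputs n E z (m(a := f))"
  by (simp add: inputs_def)

lemma inputs_simps:
  assumes "inputs n E z m"
  shows "m 0 0 = n" and "m 0 (Suc 0) = z"
    and "i < n \<Longrightarrow> j < n \<Longrightarrow> m (Suc 0) (i * n + j) = of_bool ({i, j} \<in> E)"
    and "i \<le> n \<Longrightarrow> m 2 i = 2 ^ i"
    and "bound b m = range_size b n"
proof -
  have m: "m 0 = input_memory n E z 0" "m (Suc 0) = input_memory n E z (Suc 0)"
    "m 2 = (\<lambda>i. if i \<le> n then 2 ^ i else 0)"
    using assms by (auto simp: inputs_def start_memory_def)
  show "m 0 0 = n" "m 0 (Suc 0) = z" using m by (auto simp: input_memory_def)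
  show p: "m 2 i = 2 ^ i" if "i \<le> n" for i using m that by simp
  show "bound b m = range_size b n" using \<open>m 0 0 = n\<close> p[of n] by (simp add: bound_def)
  assume ij: "i < n" "j < n"
  have "i * n + j < Suc i * n" using ij by simp
  also have "\<dots> \<le> n * n" using ij by (intro mult_le_mono) auto
  finally show "m (Suc 0) (i * n + j) = of_bool ({i, j} \<in> E)"
    using ij m by (simp add: input_memory_def)
qed

text \<open>Truth means being nonzero, so a conjunction is a product, a disjunction a sum, and an
  existential quantifier a bounded sum.\<close>

definition holds :: "tm \<Rightarrow> (nat \<Rightarrow> nat) \<Rightarrow> memory \<Rightarrow> bool" where
  "holds t \<rho> m \<longleftrightarrow> tval t \<rho> m \<noteq> 0"

definition conj_tm :: "tm \<Rightarrow> tm \<Rightarrow> tm" where "conj_tm s t = Op Times s t"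
definition disj_tm :: "tm \<Rightarrow> tm \<Rightarrow> tm" where "disj_tm s t = Op Plus s t"
definition not_tm :: "tm \<Rightarrow> tm" where "not_tm t = Op Equal t (Num 0)"
definition ex_tm :: "bool \<Rightarrow> nat \<Rightarrow> tm \<Rightarrow> tm" where "ex_tm b v t = Sum b v t"
definition all_tm :: "bool \<Rightarrow> nat \<Rightarrow> tm \<Rightarrow> tm" where
  "all_tm b v t = not_tm (ex_tm b v (not_tm t))"
definition order_tm :: tm where "order_tm = Get 0 (Num 0)"
definition goal_tm :: tm where "goal_tm = Get 0 (Num 1)"
definition pow_tm :: "tm \<Rightarrow> tm" where "pow_tm t = Get 2 t"
definition adj_tm :: "tm \<Rightarrow> tm \<Rightarrow> tm" where
  "adj_tm s t = Get 1 (Op Plus (Op Times s order_tm) t)"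
definition mem_tm :: "tm \<Rightarrow> tm \<Rightarrow> tm" where
  "mem_tm t s = Op Mod (Op Div s (pow_tm t)) (Num 2)"
definition all_but_goal_tm :: tm where
  "all_but_goal_tm = Op Monus (Op Monus (pow_tm order_tm) (Num 1)) (pow_tm goal_tm)"

lemmas tm_defs = conj_tm_def disj_tm_def not_tm_def ex_tm_def all_tm_def order_tm_def goal_tm_def
  pow_tm_def adj_tm_def mem_tm_def all_but_goal_tm_def

lemma holds_simps:
  "holds (Op Less s t) \<rho> m \<longleftrightarrow> tval s \<rho> m < tval t \<rho> m"
  "holds (Op Equal s t) \<rho> m \<longleftrightarrow> tval s \<rho> m = tval t \<rho> m"
  "holds (conj_tm s t) \<rho> m \<longleftrightarrow> holds s \<rho> m \<and> holds t \<rho> m"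
  "holds (disj_tm s t) \<rho> m \<longleftrightarrow> holds s \<rho> m \<or> holds t \<rho> m"
  "holds (not_tm t) \<rho> m \<longleftrightarrow> \<not> holds t \<rho> m"
  "holds (Get a t) \<rho> m \<longleftrightarrow> m a (tval t \<rho> m) \<noteq> 0"
  by (auto simp: holds_def tm_defs)

lemma holds_quantifiers:
  assumes "inputs n E z m"
  shows "holds (ex_tm b v t) \<rho> m \<longleftrightarrow> (\<exists>i<range_size b n. holds t (\<rho>(v := i)) m)"
    and "holds (all_tm b v t) \<rho> m \<longleftrightarrow> (\<forall>i<range_size b n. holds t (\<rho>(v := i)) m)"
proof -
  show ex: "holds (ex_tm b v t) \<rho> m \<longleftrightarrow> (\<exists>i<range_size b n. holds t (\<rho>(v := i)) m)" for t
    by (auto simp: holds_def ex_tm_def inputs_simps[OF assms])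
  show "holds (all_tm b v t) \<rho> m \<longleftrightarrow> (\<forall>i<range_size b n. holds t (\<rho>(v := i)) m)"
    by (auto simp: all_tm_def ex holds_simps)
qed

lemma tval_input_tms:
  assumes "inputs n E z m"
  shows "tval order_tm \<rho> m = n" and "tval goal_tm \<rho> m = z"
    and "tval t \<rho> m \<le> n \<Longrightarrow> tval (pow_tm t) \<rho> m = 2 ^ tval t \<rho> m"
  using inputs_simps[OF assms] by (auto simp: tm_defs)

section \<open>Vertex sets as binary numbers\<close>

lemma set_decode_iff: "x \<in> set_decode s \<longleftrightarrow> s div 2 ^ x mod 2 = 1"
  by (simp add: set_decode_def odd_iff_mod_2_eq_one)

lemma tval_adj:
  assumes "inputs n E z m" "tval s \<rho> m < n" "tval t \<rho> m < n"
  shows "tval (adj_tm s t) \<rho> m = of_bool ({tval s \<rho> m, tval t \<rho> m} \<in> E)"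
    and "holds (adj_tm s t) \<rho> m \<longleftrightarrow> {tval s \<rho> m, tval t \<rho> m} \<in> E"
  using inputs_simps[OF assms(1)] assms by (auto simp: holds_def tm_defs)

lemma tval_mem:
  assumes "inputs n E z m" "tval t \<rho> m < n"
  shows "tval (mem_tm t s) \<rho> m = of_bool (tval t \<rho> m \<in> set_decode (tval s \<rho> m))"
    and "holds (mem_tm t s) \<rho> m \<longleftrightarrow> tval t \<rho> m \<in> set_decode (tval s \<rho> m)"
  using tval_input_tms[OF assms(1)] assms
  by (auto simp: holds_def mem_tm_def set_decode_iff)

lemma set_decode_subset: "set_decode s \<subseteq> {..<n} \<longleftrightarrow> s < 2 ^ n"
proof
  assume s: "s < 2 ^ n"
  show "set_decode s \<subseteq> {..<n}"
  proof
    fix x assume "x \<in> set_decode s"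
    then have "s div 2 ^ x \<noteq> 0" by (metis set_decode_iff mod_0 zero_neq_one)
    then have "2 ^ x \<le> s" by (metis div_less linorder_not_less)
    then have "(2::nat) ^ x < 2 ^ n" using s by linarith
    then show "x \<in> {..<n}" by simp
  qed
next
  assume s: "set_decode s \<subseteq> {..<n}"
  have "set_encode (set_decode s) \<le> set_encode {..<n}"
    unfolding set_encode_def using s by (intro sum_mono2) auto
  also have "\<dots> < 2 ^ n" by (simp add: set_encode_def sum_power2 lessThan_atLeast0)
  finally show "s < 2 ^ n" by simp
qed

lemma ex_mask: "A \<subseteq> {..<n} \<Longrightarrow> \<exists>s<2 ^ n. set_decode s = A"
  using set_decode_subset[of "set_encode A" n] finite_subset[of A "{..<n}"]
  by (auto intro!: exI[of _ "set_encode A"])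

lemma set_decode_eq_iff: "set_decode s = set_decode t \<longleftrightarrow> s = t"
  by (metis set_decode_inverse)

text \<open>Deleting an element subtracts its power of 2 and gives a smaller code. A loop through
  the codes in increasing order therefore finds the entries for all smaller sets of this kind
  already computed.\<close>

lemma set_decode_minus:
  assumes "x \<in> set_decode s"
  shows "set_decode (s - 2 ^ x) = set_decode s - {x}" and "s - 2 ^ x < s"
proof -
  have f: "finite (set_decode s - {x})" by simp
  have "s = set_encode (insert x (set_decode s - {x}))"
    using assms by (simp add: insert_absorb)
  also have "\<dots> = 2 ^ x + set_encode (set_decode s - {x})"
    by (rule set_encode_insert) auto
  finally have "s = 2 ^ x + set_encode (set_decode s - {x})" .
  then show "set_decode (s - 2 ^ x) = set_decode s - {x}" "s - 2 ^ x < s"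
    by (metis add_diff_cancel_left' set_encode_inverse f)
      (use \<open>s = 2 ^ x + set_encode (set_decode s - {x})\<close> in
        \<open>metis add_gr_0 diff_less zero_less_numeral zero_less_power\<close>)
qed

lemma set_decode_full: "set_decode (2 ^ n - 1) = {..<n}"
proof -
  have "set_encode {..<n} = 2 ^ n - 1" by (simp add: set_encode_def sum_power2 lessThan_atLeast0)
  then show ?thesis by (metis finite_lessThan set_encode_inverse)
qed

lemma tval_all_but_goal:
  assumes "inputs n E z m" "z < n"
  shows "set_decode (tval all_but_goal_tm \<rho> m) = {..<n} - {z}"
    and "tval all_but_goal_tm \<rho> m < 2 ^ n"
proof -
  have "tval all_but_goal_tm \<rho> m = 2 ^ n - 1 - 2 ^ z"
    using assms(2) by (simp add: all_but_goal_tm_def tval_input_tms[OF assms(1)])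
  then show "set_decode (tval all_but_goal_tm \<rho> m) = {..<n} - {z}"
    using set_decode_minus(1)[of z "2 ^ n - 1", unfolded set_decode_full] assms(2) by simp
  then show "tval all_but_goal_tm \<rho> m < 2 ^ n"
    using set_decode_subset by blast
qed


section \<open>Maximum cardinality search\<close>

text \<open>Position 0 is included in the condition: before any visit all cardinalities are 0, so
  the first vertex stays arbitrary.\<close>

definition mcs_prefix :: "'a set \<Rightarrow> 'a set set \<Rightarrow> 'a list \<Rightarrow> bool" where
  "mcs_prefix V E vs \<longleftrightarrow> distinct vs \<and> set vs \<subseteq> V \<and>
     (\<forall>i<length vs. \<forall>w \<in> V - set (take i vs).
        card (nbrs E w \<inter> set (take i vs)) \<le> card (nbrs E (vs ! i) \<inter> set (take i vs)))"

definition mcs_set :: "'a set \<Rightarrow> 'a set set \<Rightarrow> 'a set \<Rightarrow> bool" where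
  "mcs_set V E A \<longleftrightarrow> (\<exists>vs. mcs_prefix V E vs \<and> set vs = A)"

definition mcs_next :: "'a set \<Rightarrow> 'a set set \<Rightarrow> 'a set \<Rightarrow> 'a \<Rightarrow> bool" where
  "mcs_next V E A w \<longleftrightarrow> (\<forall>x\<in>V - A. card (nbrs E x \<inter> A) \<le> card (nbrs E w \<inter> A))"

lemma mcs_prefix_snoc:
  "mcs_prefix V E (vs @ [w]) \<longleftrightarrow>
     mcs_prefix V E vs \<and> w \<in> V - set vs \<and> mcs_next V E (set vs) w"
  by (auto simp: mcs_prefix_def mcs_next_def less_Suc_eq nth_append)

text \<open>The selection rule sees the earlier vertices only as a set, so every admissible order of
  \<open>A - {w}\<close> can be continued by the same \<open>w\<close>.\<close>

lemma mcs_set_rec: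
  assumes "A \<subseteq> V"
  shows "mcs_set V E A \<longleftrightarrow>
    A = {} \<or> (\<exists>w\<in>A. mcs_set V E (A - {w}) \<and> mcs_next V E (A - {w}) w)"
proof
  assume "mcs_set V E A"
  then obtain vs where vs: "mcs_prefix V E vs" "set vs = A" unfolding mcs_set_def by blast
  show "A = {} \<or> (\<exists>w\<in>A. mcs_set V E (A - {w}) \<and> mcs_next V E (A - {w}) w)"
  proof (cases vs rule: rev_cases)
    case (snoc us w)
    then have "set us = A - {w}" "w \<in> A" using vs by (auto simp: mcs_prefix_snoc)
    then show ?thesis using vs unfolding mcs_set_def snoc mcs_prefix_snoc by metis
  qed (use vs in auto)
next
  assume *: "A = {} \<or> (\<exists>w\<in>A. mcs_set V E (A - {w}) \<and> mcs_next V E (A - {w}) w)"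
  show "mcs_set V E A"
  proof (cases "A = {}")
    case True
    then show ?thesis unfolding mcs_set_def mcs_prefix_def by (intro exI[of _ "[]"]) auto
  next
    case False
    then obtain w us where w: "w \<in> A" "mcs_next V E (A - {w}) w" "mcs_prefix V E us" "set us = A - {w}"
      using * unfolding mcs_set_def by blast
    then have "mcs_prefix V E (us @ [w])" using assms by (auto simp: mcs_prefix_snoc)
    moreover have "set (us @ [w]) = A" using w by auto
    ultimately show ?thesis unfolding mcs_set_def by blast
  qed
qed

lemma mcs_end_vertex_iff:
  assumes "z \<in> V"
  shows "is_end_vertex (mcs_ordering V E) z \<longleftrightarrow> mcs_set V E (V - {z})"
proof -
  have ord: "mcs_ordering V E vs \<longleftrightarrow> mcs_prefix V E vs \<and> set vs = V" for vs
  proof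
    assume "mcs_prefix V E vs \<and> set vs = V"
    then show "mcs_ordering V E vs" unfolding mcs_prefix_def mcs_ordering_def by auto
  next
    assume ord: "mcs_ordering V E vs"
    have "card (nbrs E w \<inter> set (take i vs)) \<le> card (nbrs E (vs ! i) \<inter> set (take i vs))"
      if "i < length vs" "w \<in> V - set (take i vs)" for i w
    proof (cases i)
      case (Suc k)
      then show ?thesis using that ord unfolding mcs_ordering_def by auto
    qed simp
    then show "mcs_prefix V E vs \<and> set vs = V"
      using ord unfolding mcs_prefix_def mcs_ordering_def by auto
  qed
  \<comment> \<open>Only \<open>z\<close> itself is left to compete for the last position.\<close>
  have nx: "mcs_next V E (V - {z}) z" unfolding mcs_next_def by auto
  show ?thesis
  proof
    assume "is_end_vertex (mcs_ordering V E) z"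
    then obtain vs where vs: "mcs_prefix V E vs" "set vs = V" "vs \<noteq> []" "last vs = z"
      unfolding is_end_vertex_def ord by blast
    then obtain us where us: "vs = us @ [z]" by (metis append_butlast_last_id)
    then have "mcs_prefix V E us" "set us = V - {z}" using vs by (auto simp: mcs_prefix_snoc)
    then show "mcs_set V E (V - {z})" unfolding mcs_set_def by blast
  next
    assume "mcs_set V E (V - {z})"
    then obtain us where us: "mcs_prefix V E us" "set us = V - {z}" unfolding mcs_set_def by blast
    then have "mcs_prefix V E (us @ [z])" using nx assms by (simp add: mcs_prefix_snoc)
    moreover have "set (us @ [z]) = V" using us assms by auto
    ultimately show "is_end_vertex (mcs_ordering V E) z"
      unfolding is_end_vertex_def ord by (intro exI[of _ "us @ [z]"]) simp
  qed
qed

definition degree_tm :: "tm \<Rightarrow> nat \<Rightarrow> tm \<Rightarrow> tm" where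
  "degree_tm s v t = Sum False v (conj_tm (adj_tm s (Var v)) (mem_tm (Var v) t))"

text \<open>\<open>rest\<close> codes the set without \<open>w\<close> only if bit \<open>w\<close>
  is set; the membership conjunct discards the meaningless differences.\<close>

definition mcs_tm :: tm where
  "mcs_tm = (let rest = Op Monus (Var 0) (pow_tm (Var 1)) in
     disj_tm (Op Equal (Var 0) (Num 0))
       (ex_tm False 1 (conj_tm (mem_tm (Var 1) (Var 0)) (conj_tm (Get 5 rest)
          (all_tm False 2 (disj_tm (mem_tm (Var 2) rest)
             (not_tm (Op Less (degree_tm (Var 1) 3 rest) (degree_tm (Var 2) 3 rest)))))))))"

lemma sum_of_bool_card:
  fixes n :: nat
  assumes "A \<subseteq> {..<n}"
  shows "(\<Sum>y<n. of_bool (P y) * of_bool (y \<in> A)) = card ({y. P y} \<inter> A)"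
proof -
  have "(\<Sum>y<n. of_bool (P y) * of_bool (y \<in> A)) = (\<Sum>y<n. of_bool (y \<in> {y. P y} \<inter> A) :: nat)"
    by (intro sum.cong) auto
  also have "\<dots> = card ({..<n} \<inter> {y. y \<in> {y. P y} \<inter> A})"
    by (subst sum_of_bool_eq) simp_all
  also have "{..<n} \<inter> {y. y \<in> {y. P y} \<inter> A} = {y. P y} \<inter> A" using assms by auto
  finally show ?thesis .
qed

lemma tval_degree:
  assumes "inputs n E z m" "\<And>i. tval s (\<rho>(v := i)) m = x" "x < n"
    and "\<And>i. tval t (\<rho>(v := i)) m = k" "k < 2 ^ n"
  shows "tval (degree_tm s v t) \<rho> m = card (nbrs E x \<inter> set_decode k)"
proof -
  have "tval (degree_tm s v t) \<rho> m =
      (\<Sum>y<n. of_bool ({x, y} \<in> E) * of_bool (y \<in> set_decode k))"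
    unfolding degree_tm_def conj_tm_def tval.simps inputs_simps(5)[OF assms(1)]
    by (intro sum.cong) (use assms in \<open>auto simp: tval_adj[OF assms(1)] tval_mem[OF assms(1)]\<close>)
  then show ?thesis
    using sum_of_bool_card[of "set_decode k" n "\<lambda>y. {x, y} \<in> E"] assms(5) set_decode_subset
    unfolding nbrs_def by simp
qed

lemma holds_mcs_tm:
  assumes m: "inputs n E z m" and s: "s < 2 ^ n" "\<rho> 0 = s"
    and IH: "\<forall>t<s. m 5 t \<noteq> 0 \<longleftrightarrow> mcs_set {..<n} E (set_decode t)"
  shows "holds mcs_tm \<rho> m \<longleftrightarrow> mcs_set {..<n} E (set_decode s)"
proof -
  let ?V = "{..<n}" and ?A = "set_decode s"
  have A: "?A \<subseteq> ?V" using s set_decode_subset by blast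
  have "holds mcs_tm \<rho> m \<longleftrightarrow> s = 0 \<or> (\<exists>w<n. w \<in> ?A \<and> m 5 (s - 2 ^ w) \<noteq> 0 \<and>
      (\<forall>x<n. x \<in> set_decode (s - 2 ^ w) \<or>
         \<not> card (nbrs E w \<inter> set_decode (s - 2 ^ w)) < card (nbrs E x \<inter> set_decode (s - 2 ^ w))))"
    using s less_imp_diff_less[OF s(1)]
    by (simp add: mcs_tm_def Let_def holds_simps holds_quantifiers[OF m] tval_mem[OF m]
        tval_degree[OF m] tval_input_tms[OF m] cong: conj_cong disj_cong)
  also have "\<dots> \<longleftrightarrow> s = 0 \<or> (\<exists>w<n. w \<in> ?A \<and> mcs_set ?V E (?A - {w}) \<and> mcs_next ?V E (?A - {w}) w)"
    using IH set_decode_minus[of _ s] unfolding mcs_next_def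
    by (auto simp: not_less cong: conj_cong)
  also have "s = 0 \<longleftrightarrow> ?A = {}" using set_decode_eq_iff[of s 0] by simp
  also have "(?A = {} \<or> (\<exists>w<n. w \<in> ?A \<and> mcs_set ?V E (?A - {w}) \<and> mcs_next ?V E (?A - {w}) w)) \<longleftrightarrow>
      mcs_set ?V E ?A"
    using A by (subst mcs_set_rec[OF A]) auto
  finally show ?thesis .
qed

lemma solvable_mcs:
  "solvable_in_exp2_poly_time (\<lambda>V E z. is_end_vertex (mcs_ordering V E) z)"
proof (rule solvable_compile[where p = "For True 0 (Asg 5 (Var 0) mcs_tm)" and \<rho> = "\<lambda>_. 0"
      and a = "Get 5 all_but_goal_tm"])
  fix n z :: nat and E assume "simple_graph {..<n} E" and z: "z < n"
  let ?V = "{..<n}" and ?p = "Asg 5 (Var 0) mcs_tm" and ?m = "start_memory n E z"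
  let ?I = "\<lambda>k m. inputs n E z m \<and> (\<forall>t<k. m 5 t \<noteq> 0 \<longleftrightarrow> mcs_set ?V E (set_decode t))"
  have "?I (2 ^ n) (run (For True 0 ?p) (\<lambda>_. 0) ?m)"
  proof (rule run_For[where I = ?I])
    show "bound True ?m = 2 ^ n" using inputs_simps(5)[OF inputs_start] by simp
    show "?I 0 ?m" using inputs_start by simp
    fix k m assume k: "k < 2 ^ n" and I: "?I k m"
    then show "?I (Suc k) (run ?p ((\<lambda>_. 0)(0 := k)) m)"
      using holds_mcs_tm[of n E z m k "(\<lambda>_. 0)(0 := k)"]
      by (auto simp: less_Suc_eq holds_def inputs_upd)
  qed
  then show "tval (Get 5 all_but_goal_tm) (\<lambda>_. 0) (run (For True 0 ?p) (\<lambda>_. 0) ?m) \<noteq> 0 \<longleftrightarrow>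
      is_end_vertex (mcs_ordering ?V E) z"
    using z tval_all_but_goal[of n E z _ "\<lambda>_. 0"] mcs_end_vertex_iff[of z ?V E] by simp
qed (simp_all add: mcs_tm_def degree_tm_def tm_defs Let_def)


section \<open>Depth-first search\<close>

lemma nbrs_sym: "y \<in> nbrs E x \<longleftrightarrow> x \<in> nbrs E y"
  by (simp add: nbrs_def insert_commute)

lemma nbrs_subset: "simple_graph V E \<Longrightarrow> nbrs E x \<subseteq> V"
  by (auto simp: simple_graph_def nbrs_def)

text \<open>Paths are listed from their final vertex \<open>u\<close> backwards, which is the order
  of a DFS stack with \<open>u\<close> on top.\<close>

definition path_set :: "'a set set \<Rightarrow> 'a set \<Rightarrow> 'a \<Rightarrow> bool" where
  "path_set E A u \<longleftrightarrow> (\<exists>p. distinct (u # p) \<and> successively (\<lambda>x y. y \<in> nbrs E x) (u # p) \<and>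
     set (u # p) = A)"

lemma path_set_rec:
  "path_set E A u \<longleftrightarrow> u \<in> A \<and> (A = {u} \<or> (\<exists>w\<in>nbrs E u. path_set E (A - {u}) w))"
proof
  assume "path_set E A u"
  then obtain p where p: "distinct (u # p)" "successively (\<lambda>x y. y \<in> nbrs E x) (u # p)"
    "set (u # p) = A" unfolding path_set_def by blast
  show "u \<in> A \<and> (A = {u} \<or> (\<exists>w\<in>nbrs E u. path_set E (A - {u}) w))"
  proof (cases p)
    case (Cons w q)
    then have "path_set E (A - {u}) w" "w \<in> nbrs E u" using p unfolding path_set_def by auto
    then show ?thesis using p by auto
  qed (use p in auto)
next
  assume *: "u \<in> A \<and> (A = {u} \<or> (\<exists>w\<in>nbrs E u. path_set E (A - {u}) w))"
  show "path_set E A u"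
  proof (cases "A = {u}")
    case True
    then show ?thesis unfolding path_set_def by (intro exI[of _ "[]"]) auto
  next
    case False
    then obtain w q where q: "w \<in> nbrs E u" "distinct (w # q)"
      "successively (\<lambda>x y. y \<in> nbrs E x) (w # q)" "set (w # q) = A - {u}"
      using * unfolding path_set_def by blast
    then show ?thesis unfolding path_set_def using *
      by (intro exI[of _ "w # q"]) auto
  qed
qed

text \<open>Connectedness, expressed by closed sets instead of walks: it becomes one quantifier over
  subsets and combines directly with inductions over a search.\<close>

definition linked :: "'a set \<Rightarrow> 'a set set \<Rightarrow> 'a \<Rightarrow> bool" where
  "linked V E z \<longleftrightarrow> (\<forall>A\<subseteq>V. z \<in> A \<longrightarrow> (\<forall>x\<in>A. nbrs E x \<subseteq> A) \<longrightarrow> A = V)"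

section \<open>What a depth-first search reveals about its last vertex\<close>

lemma dfs_state_invariants:
  assumes "simple_graph V E" and "dfs_state V E vs st"
  shows "distinct vs \<and> set vs \<subseteq> V \<and> vs \<noteq> [] \<and> distinct st \<and> set st \<subseteq> set vs \<and>
    successively (\<lambda>x y. y \<in> nbrs E x) st \<and> (\<forall>x\<in>set vs - set st. nbrs E x \<subseteq> set vs)"
  using assms(2)
proof induction
  case (advance vs u st w)
  then show ?case using nbrs_subset[OF assms(1), of u] by (auto simp: nbrs_sym[of w])
next
  case (backtrack vs u st)
  then show ?case by (auto simp: successively_Cons)
qed auto

text \<open>The path is the stack at the moment when the last vertex is visited. A visited vertex
  that is off the stack at that moment was left by backtracking, so all its neighbours had been
  visited before.\<close>

lemma dfs_last_path:
  assumes "simple_graph V E" and "dfs_state V E vs st"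
  shows "\<exists>p. distinct (last vs # p) \<and> successively (\<lambda>x y. y \<in> nbrs E x) (last vs # p) \<and>
    set (last vs # p) \<subseteq> set vs \<and> (\<forall>x\<in>set vs - set (last vs # p). nbrs E x \<subseteq> set (butlast vs))"
  using assms(2)
proof induction
  case (start s)
  then show ?case by (intro exI[of _ "[]"]) auto
next
  case (advance vs u st w)
  then show ?case
    using dfs_state_invariants[OF assms(1) advance.hyps(1)]
    by (intro exI[of _ "u # st"]) (auto simp: nbrs_sym[of w])
\<comment> \<open>Backtracking leaves \<open>vs\<close> unchanged, so in that case the induction
  hypothesis is the goal.\<close>
qed

text \<open>Each new vertex is adjacent to a visited one, so the search cannot cross the boundary of
  a closed set in either direction.\<close>

lemma dfs_state_component:
  assumes "dfs_state V E vs st" and "simple_graph V E" and "\<forall>x\<in>A. nbrs E x \<subseteq> A"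
  shows "set vs \<subseteq> A \<or> set vs \<inter> A = {}"
  using assms(1)
proof induction
  case (advance vs u st w)
  then have "u \<in> set vs" using dfs_state_invariants[OF assms(2) advance.hyps(1)] by auto
  moreover have "u \<in> nbrs E w" "w \<in> nbrs E u" using advance by (auto simp: nbrs_sym)
  ultimately show ?case using advance.IH assms(3) by auto
qed auto

lemma dfs_state_finish:
  assumes "simple_graph V E" and "dfs_state V E vs st" and "set vs = V"
  shows "dfs_state V E vs []"
  using assms(2)
proof (induction st rule: list.induct)
  case (Cons u st)
  have "nbrs E u \<subseteq> set vs" using nbrs_subset[OF assms(1)] assms(3) by blast
  then show ?case using Cons.IH Cons.prems by (blast intro: dfs_state.backtrack)
qed

section \<open>Steering a depth-first search along a path\<close>

text \<open>An excursion into \<open>C\<close> can be completed inside \<open>C\<close>: the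
  neighbours of its vertices lie in \<open>C\<close> or are visited already, so each of its vertices
  is finally left by backtracking and the old stack reappears.\<close>

lemma dfs_explore:
  assumes G: "simple_graph V E" and "dfs_state V E vs (u # st)" and "C \<subseteq> V - set vs"
    and "\<forall>x\<in>C. nbrs E x \<subseteq> C \<union> set vs"
  shows "\<exists>vs'. dfs_state V E vs' (u # st) \<and> set vs \<subseteq> set vs' \<and> set vs' \<subseteq> set vs \<union> C \<and>
    nbrs E u \<inter> C \<subseteq> set vs'"
  using assms(2-)
proof (induction "card C" arbitrary: C vs u st rule: less_induct)
  case less
  have fin: "finite C" using less.prems G by (auto simp: simple_graph_def intro: finite_subset)
  show ?case
  proof (cases "nbrs E u \<inter> C = {}")
    case True
    then show ?thesis using less.prems by blast
  next
    case False
    then obtain w where w: "w \<in> nbrs E u" "w \<in> C" by blast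
    \<comment> \<open>The induction hypothesis is used twice: below \<open>w\<close> for
      \<open>C - {w}\<close>, and after the return to \<open>u\<close> for what is left of
      \<open>C\<close>.\<close>
    have "dfs_state V E (vs @ [w]) (w # u # st)"
      using less.prems w by (intro dfs_state.advance) auto
    moreover have "card (C - {w}) < card C" using fin w by (intro card_Diff1_less)
    ultimately obtain vs1 where 1: "dfs_state V E vs1 (w # u # st)" "set (vs @ [w]) \<subseteq> set vs1"
      "set vs1 \<subseteq> set (vs @ [w]) \<union> (C - {w})" "nbrs E w \<inter> (C - {w}) \<subseteq> set vs1"
      using less.hyps[of "C - {w}" "vs @ [w]" w "u # st"] less.prems by fastforce
    have "nbrs E w \<subseteq> C \<union> set vs" using less.prems(3) w by blast
    then have "nbrs E w \<subseteq> set vs1" using 1 by auto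
    with 1(1) have s1: "dfs_state V E vs1 (u # st)" by (rule dfs_state.backtrack)
    have "card (C - set vs1) < card C"
      using fin w 1 by (intro psubset_card_mono) auto
    moreover have "\<forall>x\<in>C - set vs1. nbrs E x \<subseteq> (C - set vs1) \<union> set vs1"
    proof
      fix x assume "x \<in> C - set vs1"
      then have "nbrs E x \<subseteq> C \<union> set vs" using less.prems(3) by blast
      then show "nbrs E x \<subseteq> (C - set vs1) \<union> set vs1" using 1(2) by auto
    qed
    moreover have "C - set vs1 \<subseteq> V - set vs1" using less.prems by auto
    ultimately obtain vs2 where "dfs_state V E vs2 (u # st)" "set vs1 \<subseteq> set vs2"
      "set vs2 \<subseteq> set vs1 \<union> (C - set vs1)" "nbrs E u \<inter> (C - set vs1) \<subseteq> set vs2"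
      using less.hyps[of "C - set vs1" vs1 u st] s1 by blast
    then show ?thesis using 1 w by (intro exI[of _ vs2]) auto
  qed
qed

text \<open>The invariant of the search that follows a path to \<open>z\<close>: every component of the graph of
  unvisited vertices contains \<open>z\<close>.\<close>

definition rest_linked :: "'a set \<Rightarrow> 'a set set \<Rightarrow> 'a \<Rightarrow> 'a set \<Rightarrow> bool" where
  "rest_linked V E z X \<longleftrightarrow>
     (\<forall>C\<subseteq>V - X - {z}. (\<forall>x\<in>C. nbrs E x \<subseteq> C \<union> X) \<longrightarrow> C = {})"

text \<open>A path can enter \<open>C\<close> from outside only through \<open>X\<close>. This
  protects the rest of the path to \<open>z\<close> from being consumed by an exploration of
  \<open>C\<close>.\<close>

lemma path_avoids:
  assumes "successively (\<lambda>x y. y \<in> nbrs E x) r" and "r \<noteq> [] \<Longrightarrow> hd r \<notin> C"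
    and "\<forall>x\<in>C. nbrs E x \<subseteq> C \<union> X" and "set r \<inter> X = {}"
  shows "set r \<inter> C = {}"
  using assms
proof (induction r)
  case (Cons x r)
  have "hd r \<notin> C" if "r \<noteq> []"
  proof
    assume "hd r \<in> C"
    moreover have "hd r \<in> nbrs E x" using Cons.prems(1) that by (auto simp: successively_Cons)
    ultimately have "x \<in> C \<union> X" using Cons.prems(3) nbrs_sym by fastforce
    then show False using Cons.prems by auto
  qed
  then show ?case using Cons by (auto simp: successively_Cons)
qed simp

text \<open>Restores the invariant after a visit to \<open>u\<close>. Before the visit every
  component of the unvisited graph contained \<open>z\<close>; a component that the removal of
  \<open>u\<close> separates from \<open>z\<close> is hence adjacent to \<open>u\<close> and can be
  explored from there.\<close>

lemma dfs_clear:
  assumes G: "simple_graph V E" and st: "dfs_state V E (vs @ [u]) (u # q)"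
    and q: "set q \<subseteq> set vs" and J: "rest_linked V E z (set vs)" and z: "z \<notin> set (vs @ [u])"
    and r: "successively (\<lambda>x y. y \<in> nbrs E x) r" "r \<noteq> []" "hd r = z" "set r \<inter> set (vs @ [u]) = {}"
  shows "\<exists>vs'. dfs_state V E vs' (u # q) \<and> rest_linked V E z (set vs') \<and> set r \<inter> set vs' = {}"
proof -
  let ?X = "set (vs @ [u])"
  \<comment> \<open>The union is itself closed relative to \<open>?X\<close>, so \<open>C\<close> is
    the largest such set that avoids \<open>z\<close>.\<close>
  define C where "C = \<Union>{C. C \<subseteq> V - ?X - {z} \<and> (\<forall>x\<in>C. nbrs E x \<subseteq> C \<union> ?X)}"
  have C: "C \<subseteq> V - ?X - {z}" "\<forall>x\<in>C. nbrs E x \<subseteq> C \<union> ?X" unfolding C_def by blast+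
  obtain vs' where vs': "dfs_state V E vs' (u # q)" "?X \<subseteq> set vs'" "set vs' \<subseteq> ?X \<union> C"
    "nbrs E u \<inter> C \<subseteq> set vs'"
    using dfs_explore[OF G st _ C(2)] C(1) by blast
  have closed: "\<forall>x\<in>set vs' - ?X. nbrs E x \<subseteq> set vs'"
    using dfs_state_invariants[OF G vs'(1)] q by auto
  have "rest_linked V E z (set vs')"
    unfolding rest_linked_def
  proof (intro allI impI)
    fix D assume D: "D \<subseteq> V - set vs' - {z}" "\<forall>x\<in>D. nbrs E x \<subseteq> D \<union> set vs'"
    \<comment> \<open>Together with the freshly visited vertices \<open>D\<close> is closed relative
      to \<open>?X\<close>, hence part of the largest set \<open>C\<close>. As all neighbours of
      \<open>u\<close> in \<open>C\<close> are visited, \<open>u\<close> has none in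
      \<open>D\<close>, and a nonempty \<open>D\<close> would contradict the invariant from before
      the visit to \<open>u\<close>.\<close>
    have "D \<union> (set vs' - ?X) \<subseteq> C"
      unfolding C_def
    proof (intro Union_upper, rule CollectI, intro conjI)
      show "D \<union> (set vs' - ?X) \<subseteq> V - ?X - {z}" using D(1) vs'(2,3) C(1) by blast
      show "\<forall>x\<in>D \<union> (set vs' - ?X). nbrs E x \<subseteq> D \<union> (set vs' - ?X) \<union> ?X"
        using D(2) closed vs'(2) by blast
    qed
    then have u: "nbrs E u \<inter> D = {}" using vs'(4) D(1) by blast
    have "nbrs E x \<subseteq> D \<union> set vs" if x: "x \<in> D" for x
    proof
      fix y assume y: "y \<in> nbrs E x"
      then have "y \<in> D \<union> set vs'" "x \<in> nbrs E y" using D(2) x nbrs_sym by fastforce+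
      moreover have "x \<notin> set vs'" using D(1) x by blast
      ultimately show "y \<in> D \<union> set vs" using closed u x by auto
    qed
    moreover have "D \<subseteq> V - set vs - {z}" using D(1) vs'(2) by auto
    ultimately show "D = {}" using J unfolding rest_linked_def by blast
  qed
  moreover have "set r \<inter> C = {}" using path_avoids[OF r(1) _ C(2) r(4)] C(1) r(3) by blast
  then have "set r \<inter> set vs' = {}" using vs'(3) r(4) by blast
  ultimately show ?thesis using vs'(1) by blast
qed

text \<open>\<open>r @ q\<close> is the path read from \<open>z\<close>: \<open>q\<close> is the
  stack, ending in the start vertex, and \<open>r\<close> is the part not yet walked.
  \<open>r\<close> is generalized because each vertex taken off \<open>q\<close> in the induction
  joins it.\<close>

lemma dfs_follow_path:
  assumes G: "simple_graph V E" and l: "linked V E z"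
    and "distinct (r @ q)" "successively (\<lambda>x y. y \<in> nbrs E x) (r @ q)" "set (r @ q) \<subseteq> V"
      "r \<noteq> []" "hd r = z" "q \<noteq> []"
  shows "\<exists>vs. dfs_state V E vs q \<and> rest_linked V E z (set vs) \<and> set r \<inter> set vs = {}"
  using assms(3-)
proof (induction q arbitrary: r)
  case (Cons u q)
  have r: "successively (\<lambda>x y. y \<in> nbrs E x) r" using Cons.prems by (simp add: successively_append_iff)
  have u: "u \<in> V" "u \<noteq> z" "u \<notin> set r" using Cons.prems by (cases r; auto)+
  show ?case
  proof (cases "q = []")
    case True
    \<comment> \<open>With nothing visited, the complement of a closed set is closed by symmetry of
      adjacency; it contains \<open>z\<close>, so \<open>linked\<close> makes it everything.\<close>
    have "rest_linked V E z (set [])"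
      unfolding rest_linked_def
    proof (intro allI impI)
      fix C assume C: "C \<subseteq> V - set [] - {z}" "\<forall>x\<in>C. nbrs E x \<subseteq> C \<union> set []"
      have "nbrs E x \<subseteq> V - C" if "x \<in> V - C" for x
        using C(2) that nbrs_subset[OF G, of x] nbrs_sym[of _ E x] by fastforce
      moreover have "z \<in> V - C" using C(1) Cons.prems by (cases r) auto
      ultimately have "V - C = V" using l unfolding linked_def by blast
      then show "C = {}" using C(1) by blast
    qed
    moreover have "dfs_state V E ([] @ [u]) [u]" using u by (simp add: dfs_state.start)
    ultimately show ?thesis
      using dfs_clear[OF G _ _ _ _ r, of "[]" u "[]" z] Cons.prems u True by auto
  next
    case False
    obtain vs where vs: "dfs_state V E vs q" "rest_linked V E z (set vs)" "set (r @ [u]) \<inter> set vs = {}"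
      using Cons.IH[of "r @ [u]"] Cons.prems False by auto
    obtain v q' where q: "q = v # q'" using False by (cases q) auto
    have "u \<in> nbrs E v"
      using Cons.prems q by (simp add: successively_append_iff nbrs_sym[of u])
    then have st: "dfs_state V E (vs @ [u]) (u # q)"
      using vs unfolding q by (intro dfs_state.advance) auto
    have "set q \<subseteq> set vs" using dfs_state_invariants[OF G vs(1)] by blast
    then show ?thesis
      using Cons.prems u vs(3)
      by (intro dfs_clear[OF G st _ vs(2) _ r]) (cases r; auto)+
  qed
qed simp

lemma dfs_end_vertex_iff:
  assumes G: "simple_graph V E" and z: "z \<in> V"
  shows "is_end_vertex (dfs_ordering V E) z \<longleftrightarrow>
    linked V E z \<and> (\<exists>A\<subseteq>V. path_set E A z \<and> nbrs E z \<subseteq> A)"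
proof
  assume "is_end_vertex (dfs_ordering V E) z"
  then obtain vs where vs: "dfs_state V E vs []" "set vs = V" "vs \<noteq> []" "last vs = z"
    unfolding is_end_vertex_def dfs_ordering_def by blast
  have l: "linked V E z"
    unfolding linked_def using dfs_state_component[OF vs(1) G] vs(2) z by blast
  obtain p where p: "distinct (z # p)" "successively (\<lambda>x y. y \<in> nbrs E x) (z # p)"
    "set (z # p) \<subseteq> V" "\<forall>x\<in>V - set (z # p). nbrs E x \<subseteq> set (butlast vs)"
    using dfs_last_path[OF G vs(1)] vs(2,4) by blast
  have "distinct vs" using dfs_state_invariants[OF G vs(1)] by blast
  moreover have "vs = butlast vs @ [z]" using append_butlast_last_id[OF vs(3)] vs(4) by simp
  ultimately have "distinct (butlast vs @ [z])" by (rule subst[rotated])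
  then have "z \<notin> set (butlast vs)" by simp
  have "nbrs E z \<subseteq> set (z # p)"
  proof
    fix y assume y: "y \<in> nbrs E z"
    then have "z \<in> nbrs E y" by (simp add: nbrs_sym[of z])
    show "y \<in> set (z # p)"
    proof (rule ccontr)
      assume "y \<notin> set (z # p)"
      then have "y \<in> V - set (z # p)" using y nbrs_subset[OF G, of z] by auto
      then have "nbrs E y \<subseteq> set (butlast vs)" by (rule bspec[OF p(4)])
      then show False using \<open>z \<in> nbrs E y\<close> \<open>z \<notin> set (butlast vs)\<close> by auto
    qed
  qed
  then have "\<exists>A\<subseteq>V. path_set E A z \<and> nbrs E z \<subseteq> A"
    using p unfolding path_set_def by (intro exI[of _ "set (z # p)"]) blast
  with l show "linked V E z \<and> (\<exists>A\<subseteq>V. path_set E A z \<and> nbrs E z \<subseteq> A)" by blast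
next
  assume "linked V E z \<and> (\<exists>A\<subseteq>V. path_set E A z \<and> nbrs E z \<subseteq> A)"
  then obtain p where l: "linked V E z" and p: "distinct (z # p)"
    "successively (\<lambda>x y. y \<in> nbrs E x) (z # p)" "set (z # p) \<subseteq> V" "nbrs E z \<subseteq> set (z # p)"
    unfolding path_set_def by blast
  have "\<exists>vs st. dfs_state V E (vs @ [z]) st \<and> set (vs @ [z]) = V"
  proof (cases p)
    case Nil
    have "{z} = V" using l p z unfolding linked_def Nil by auto
    moreover have "dfs_state V E ([] @ [z]) [z]" using z by (simp add: dfs_state.start)
    ultimately show ?thesis by (intro exI[of _ "[]"] exI[of _ "[z]"]) simp
  next
    case (Cons u q)
    then obtain vs where vs: "dfs_state V E vs p" "rest_linked V E z (set vs)" "z \<notin> set vs"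
      using dfs_follow_path[OF G l, of "[z]" p] p by auto
    have inv: "set vs \<subseteq> V" "set p \<subseteq> set vs" using dfs_state_invariants[OF G vs(1)] by auto
    \<comment> \<open>All neighbours of \<open>z\<close> lie on the path and are visited, so no
      unvisited vertex except \<open>z\<close> is adjacent to \<open>z\<close>. The remaining
      vertices thus form a closed set without \<open>z\<close>, which the invariant forces to be
      empty.\<close>
    have "nbrs E x \<subseteq> (V - set vs - {z}) \<union> set vs" if "x \<in> V - set vs - {z}" for x
      using that p(4) inv nbrs_subset[OF G, of x] nbrs_sym[of z E x] by auto
    then have "V - set vs - {z} = {}" using vs(2) unfolding rest_linked_def by blast
    moreover have "dfs_state V E (vs @ [z]) (z # p)"
      using vs p(2) unfolding Cons by (intro dfs_state.advance) (auto simp: nbrs_sym[of z])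
    ultimately show ?thesis using inv z by (intro exI[of _ vs] exI[of _ "z # p"]) auto
  qed
  then obtain vs where "dfs_state V E (vs @ [z]) []" "set (vs @ [z]) = V"
    using dfs_state_finish[OF G] by blast
  then show "is_end_vertex (dfs_ordering V E) z"
    unfolding is_end_vertex_def dfs_ordering_def by (intro exI[of _ "vs @ [z]"]) simp
qed

section \<open>Evaluating the criterion for depth-first search\<close>

text \<open>Computes table indices; it is injective as long as second components stay below 2 ^
  n.\<close>

definition pair_tm :: "tm \<Rightarrow> tm \<Rightarrow> tm" where
  "pair_tm s t = Op Plus (Op Times s (pow_tm order_tm)) t"

lemma tval_pair: "inputs n E z m \<Longrightarrow> tval (pair_tm s t) \<rho> m = tval s \<rho> m * 2 ^ n + tval t \<rho> m"
  by (simp add: pair_tm_def tval_input_tms)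

lemma pair_eq_iff:
  assumes "i < N" "j < (N::nat)"
  shows "a * N + i = b * N + j \<longleftrightarrow> a = b \<and> i = j"
proof
  assume eq: "a * N + i = b * N + j"
  then have "(a * N + i) div N = (b * N + j) div N" "(a * N + i) mod N = (b * N + j) mod N" by simp_all
  then show "a = b \<and> i = j" using assms by simp
qed simp

definition path_tm :: tm where
  "path_tm = conj_tm (mem_tm (Var 1) (Var 0)) (disj_tm (Op Equal (Var 0) (pow_tm (Var 1)))
     (ex_tm False 2 (conj_tm (adj_tm (Var 1) (Var 2))
       (Get 5 (pair_tm (Op Monus (Var 0) (pow_tm (Var 1))) (Var 2))))))"

definition linked_tm :: tm where
  "linked_tm = all_tm True 0 (disj_tm (not_tm (mem_tm goal_tm (Var 0))) (disj_tm
     (ex_tm False 1 (ex_tm False 2 (conj_tm (mem_tm (Var 1) (Var 0))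
       (conj_tm (adj_tm (Var 1) (Var 2)) (not_tm (mem_tm (Var 2) (Var 0)))))))
     (Op Equal (Op Plus (Var 0) (Num 1)) (pow_tm order_tm))))"

definition dfs_tm :: tm where
  "dfs_tm = conj_tm linked_tm (ex_tm True 0 (conj_tm (Get 5 (pair_tm (Var 0) goal_tm))
     (all_tm False 1 (disj_tm (not_tm (adj_tm goal_tm (Var 1))) (mem_tm (Var 1) (Var 0))))))"

lemma holds_path_tm:
  assumes m: "inputs n E z m" and s: "s < 2 ^ n" "\<rho> 0 = s" "\<rho> 1 = u" "u < n"
    and E: "simple_graph {..<n} E"
    and IH: "\<forall>t<s. \<forall>w<n. m 5 (t * 2 ^ n + w) \<noteq> 0 \<longleftrightarrow> path_set E (set_decode t) w"
  shows "holds path_tm \<rho> m \<longleftrightarrow> path_set E (set_decode s) u"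
proof -
  have "holds path_tm \<rho> m \<longleftrightarrow> u \<in> set_decode s \<and> (s = 2 ^ u \<or>
      (\<exists>w<n. {u, w} \<in> E \<and> m 5 ((s - 2 ^ u) * 2 ^ n + w) \<noteq> 0))"
    using s by (simp add: path_tm_def holds_simps holds_quantifiers[OF m] tval_mem[OF m] tval_adj[OF m]
        tval_input_tms[OF m] tval_pair[OF m] cong: conj_cong)
  also have "\<dots> \<longleftrightarrow> u \<in> set_decode s \<and> (s = 2 ^ u \<or>
      (\<exists>w<n. {u, w} \<in> E \<and> path_set E (set_decode s - {u}) w))"
    using IH set_decode_minus[of u s] by (auto cong: conj_cong)
  also have "s = 2 ^ u \<longleftrightarrow> set_decode s = {u}"
    using set_decode_eq_iff[of s "2 ^ u"] set_decode_plus_power_2[of u 0] by simp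
  also have "(\<exists>w<n. {u, w} \<in> E \<and> path_set E (set_decode s - {u}) w) \<longleftrightarrow>
      (\<exists>w\<in>nbrs E u. path_set E (set_decode s - {u}) w)"
    using nbrs_subset[OF E, of u] by (auto simp: nbrs_def)
  finally show ?thesis using path_set_rec[of E "set_decode s" u] by simp
qed

lemma ball_masks: "(\<forall>s<2 ^ n. P (set_decode s)) \<longleftrightarrow> (\<forall>A\<subseteq>{..<n}. P A)"
proof (intro iffI allI impI)
  fix A assume "\<forall>s<2 ^ n. P (set_decode s)" and "A \<subseteq> {..<n}"
  then show "P A" using ex_mask[of A n] by blast
next
  fix s :: nat assume "\<forall>A\<subseteq>{..<n}. P A" and "s < 2 ^ n"
  then show "P (set_decode s)" using set_decode_subset[of s n] by blast
qed

lemma holds_linked_tm: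
  assumes m: "inputs n E z m" and z: "z < n" and E: "simple_graph {..<n} E"
  shows "holds linked_tm \<rho> m \<longleftrightarrow> linked {..<n} E z"
proof -
  have full: "s + 1 = 2 ^ n \<longleftrightarrow> set_decode s = {..<n}" for s
  proof -
    have "s + 1 = 2 ^ n \<longleftrightarrow> s = 2 ^ n - 1" by auto
    then show ?thesis using set_decode_eq_iff[of s "2 ^ n - 1"] unfolding set_decode_full by simp
  qed
  have "holds linked_tm \<rho> m \<longleftrightarrow> (\<forall>s<2 ^ n. z \<notin> set_decode s \<or>
      (\<exists>x<n. \<exists>y<n. x \<in> set_decode s \<and> {x, y} \<in> E \<and> y \<notin> set_decode s) \<or> s + 1 = 2 ^ n)"
    using z by (simp add: linked_tm_def holds_simps holds_quantifiers[OF m] tval_mem[OF m] tval_adj[OF m]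
        tval_input_tms[OF m] cong: conj_cong)
  also have "\<dots> \<longleftrightarrow> (\<forall>A\<subseteq>{..<n}. z \<notin> A \<or>
      (\<exists>x<n. \<exists>y<n. x \<in> A \<and> {x, y} \<in> E \<and> y \<notin> A) \<or> A = {..<n})"
    unfolding full by (rule ball_masks)
  also have "\<dots> \<longleftrightarrow> linked {..<n} E z"
  proof -
    have leaves: "(\<exists>x<n. \<exists>y<n. x \<in> A \<and> {x, y} \<in> E \<and> y \<notin> A) \<longleftrightarrow> \<not> (\<forall>x\<in>A. nbrs E x \<subseteq> A)"
      (is "?l A \<longleftrightarrow> ?r A") if "A \<subseteq> {..<n}" for A
    proof
      assume "?l A"
      then show "?r A" unfolding nbrs_def by blast
    next
      assume "?r A"
      then obtain x y where "x \<in> A" "y \<in> nbrs E x" "y \<notin> A" by blast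
      then show "?l A" using that nbrs_subset[OF E, of x] unfolding nbrs_def by blast
    qed
    have "(z \<notin> A \<or> ?l A \<or> A = {..<n}) \<longleftrightarrow>
        (z \<in> A \<longrightarrow> (\<forall>x\<in>A. nbrs E x \<subseteq> A) \<longrightarrow> A = {..<n})" if "A \<subseteq> {..<n}" for A
      unfolding leaves[OF that] by argo
    then show ?thesis unfolding linked_def by (rule all_cong)
  qed
  finally show ?thesis .
qed

lemma holds_dfs_tm:
  assumes m: "inputs n E z m" and z: "z < n" and E: "simple_graph {..<n} E"
    and tab: "\<forall>t<2 ^ n. \<forall>w<n. m 5 (t * 2 ^ n + w) \<noteq> 0 \<longleftrightarrow> path_set E (set_decode t) w"
  shows "holds dfs_tm \<rho> m \<longleftrightarrow> is_end_vertex (dfs_ordering {..<n} E) z"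
proof -
  have "holds dfs_tm \<rho> m \<longleftrightarrow> linked {..<n} E z \<and>
     (\<exists>s<2 ^ n. path_set E (set_decode s) z \<and> (\<forall>y<n. {z, y} \<notin> E \<or> y \<in> set_decode s))"
    using z tab
    by (simp add: dfs_tm_def holds_linked_tm[OF m z E] holds_simps holds_quantifiers[OF m] tval_mem[OF m]
        tval_adj[OF m] tval_input_tms[OF m] tval_pair[OF m] cong: conj_cong)
  also have "(\<exists>s<2 ^ n. path_set E (set_decode s) z \<and> (\<forall>y<n. {z, y} \<notin> E \<or> y \<in> set_decode s)) \<longleftrightarrow>
     (\<exists>A\<subseteq>{..<n}. path_set E A z \<and> (\<forall>y<n. {z, y} \<notin> E \<or> y \<in> A))"
    using ball_masks[of n "\<lambda>A. \<not> (path_set E A z \<and> (\<forall>y<n. {z, y} \<notin> E \<or> y \<in> A))"] by blast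
  also have "\<dots> \<longleftrightarrow> (\<exists>A\<subseteq>{..<n}. path_set E A z \<and> nbrs E z \<subseteq> A)"
  proof -
    have "(\<forall>y<n. {z, y} \<notin> E \<or> y \<in> A) \<longleftrightarrow> nbrs E z \<subseteq> A" for A
      using nbrs_subset[OF E, of z] unfolding nbrs_def by blast
    then show ?thesis by simp
  qed
  also have "linked {..<n} E z \<and> (\<exists>A\<subseteq>{..<n}. path_set E A z \<and> nbrs E z \<subseteq> A) \<longleftrightarrow>
      is_end_vertex (dfs_ordering {..<n} E) z"
    using dfs_end_vertex_iff[OF E, of z] z by (simp only: lessThan_iff)
  finally show ?thesis .
qed

lemma solvable_dfs:
  "solvable_in_exp2_poly_time (\<lambda>V E z. is_end_vertex (dfs_ordering V E) z)"
proof (rule solvable_compile[where \<rho> = "\<lambda>_. 0" and a = dfs_tm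
      and p = "For True 0 (For False 1 (Asg 5 (pair_tm (Var 0) (Var 1)) path_tm))"])
  fix n z :: nat and E assume E: "simple_graph {..<n} E" and z: "z < n"
  let ?p = "Asg 5 (pair_tm (Var 0) (Var 1)) path_tm" and ?m = "start_memory n E z"
  let ?P = "\<lambda>m t w. m 5 (t * 2 ^ n + w) \<noteq> 0 \<longleftrightarrow> path_set E (set_decode t) w"
  let ?I = "\<lambda>k m. inputs n E z m \<and> (\<forall>t<k. \<forall>w<n. ?P m t w)"
  have n: "w < 2 ^ n" if "w < n" for w using that less_exp[of n] by linarith
  let ?m' = "run (For True 0 (For False 1 ?p)) (\<lambda>_. 0) ?m"
  have "?I (2 ^ n) ?m'"
  proof (rule run_For[where I = ?I])
    show "bound True ?m = 2 ^ n" using inputs_simps(5)[OF inputs_start] by simp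
    show "?I 0 ?m" using inputs_start by simp
    fix k m assume k: "k < 2 ^ n" and I: "?I k m"
    let ?J = "\<lambda>j m. ?I k m \<and> (\<forall>w<j. ?P m k w)"
    have "?J n (run (For False 1 ?p) ((\<lambda>_. 0)(0 := k)) m)"
    proof (rule run_For[where I = ?J])
      show "bound False m = n" using inputs_simps(5)[of n E z m False] I by simp
      show "?J 0 m" using I by simp
      fix j m assume j: "j < n" and J: "?J j m"
      let ?\<rho> = "((\<lambda>_. 0)(0 := k, 1 := j)) :: nat \<Rightarrow> nat"
      have "holds path_tm ?\<rho> m \<longleftrightarrow> path_set E (set_decode k) j"
        using J j k E by (intro holds_path_tm) auto
      moreover have "tval (pair_tm (Var 0) (Var 1)) ?\<rho> m = k * 2 ^ n + j"
        using tval_pair[of n E z m] J by simp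
      ultimately show "?J (Suc j) (run ?p ?\<rho> m)"
        using J n j by (auto simp: less_Suc_eq holds_def inputs_upd pair_eq_iff)
    qed
    then show "?I (Suc k) (run (For False 1 ?p) ((\<lambda>_. 0)(0 := k)) m)"
      by (auto simp: less_Suc_eq)
  qed
  then have m: "inputs n E z ?m'" and tab: "\<forall>t<2 ^ n. \<forall>w<n. ?P ?m' t w" by auto
  show "tval dfs_tm (\<lambda>_. 0) ?m' \<noteq> 0 \<longleftrightarrow> is_end_vertex (dfs_ordering {..<n} E) z"
    using holds_dfs_tm[OF m z E tab] unfolding holds_def .
qed (simp_all add: path_tm_def dfs_tm_def linked_tm_def pair_tm_def tm_defs)


section \<open>Breadth-first search\<close>

text \<open>What a search from \<open>s\<close> has visited once exactly \<open>S\<close> is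
  processed; \<open>s\<close> is inserted separately because no other vertex has to discover
  it.\<close>

definition visited_from :: "'a set set \<Rightarrow> 'a \<Rightarrow> 'a set \<Rightarrow> 'a set" where
  "visited_from E s S = insert s (\<Union>x\<in>S. nbrs E x)"

lemma visited_from_mono: "S \<subseteq> T \<Longrightarrow> visited_from E s S \<subseteq> visited_from E s T"
  unfolding visited_from_def by blast

lemma visited_from_insert: "visited_from E s (insert q S) = visited_from E s S \<union> nbrs E q"
  unfolding visited_from_def by blast

text \<open>Describes \<open>p\<close> being discovered while \<open>q\<close> is processed. The
  lower bound on \<open>T\<close> expresses that whatever \<open>S\<close> reaches is visited before
  \<open>q\<close> is dequeued; between the bounds the tie-breaking is free.\<close>

definition bfs_next :: "'a set set \<Rightarrow> 'a \<Rightarrow> 'a set \<Rightarrow> 'a \<Rightarrow> 'a set \<Rightarrow> 'a \<Rightarrow> bool" where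
  "bfs_next E s S q T p \<longleftrightarrow> visited_from E s S \<subseteq> T \<and> T \<subseteq> visited_from E s S \<union> nbrs E q \<and>
     p \<in> nbrs E q \<and> p \<notin> T"

inductive bfs_chain :: "'a set set \<Rightarrow> 'a \<Rightarrow> nat \<Rightarrow> 'a set \<Rightarrow> 'a \<Rightarrow> bool"
  for E :: "'a set set" and s :: 'a where
  chain_start: "bfs_chain E s 0 {} s"
| chain_step: "bfs_chain E s i S q \<Longrightarrow> bfs_next E s S q T p \<Longrightarrow> bfs_chain E s (Suc i) T p"

lemma bfs_state_invariants:
  assumes "simple_graph V E" and "bfs_state V E vs q"
  shows "distinct vs \<and> set vs \<subseteq> V \<and> vs \<noteq> [] \<and>
    (\<exists>D. vs = D @ q \<and> set vs = visited_from E (hd vs) (set D))"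
  using assms(2)
proof induction
  case (start s)
  then show ?case by (auto simp: visited_from_def)
next
  case (dequeue vs u q ws)
  then obtain D where D: "vs = D @ u # q" "set vs = visited_from E (hd vs) (set D)" by blast
  have "vs @ ws = (D @ [u]) @ (q @ ws)" using D(1) by simp
  moreover have "set (vs @ ws) = visited_from E (hd (vs @ ws)) (set (D @ [u]))"
    using D(2) dequeue by (simp add: visited_from_insert)
  moreover have "distinct (vs @ ws)" "set (vs @ ws) \<subseteq> V" "vs @ ws \<noteq> []"
    using dequeue nbrs_subset[OF assms(1), of u] by auto
  ultimately show ?case by blast
qed

text \<open>The witness \<open>j\<close> is the position of the vertex that discovers
  \<open>vs ! k\<close>; what precedes it in \<open>vs\<close> is the processed part
  \<open>D\<close>.\<close>

lemma bfs_state_parent: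
  assumes "simple_graph V E" and "bfs_state V E vs q" and "0 < k" and "k < length vs"
  shows "\<exists>j<k. bfs_next E (hd vs) (set (take j vs)) (vs ! j) (set (take k vs)) (vs ! k)"
  using assms(2-)
proof induction
  case (dequeue vs u q ws)
  have ne: "vs \<noteq> []" using bfs_state_invariants[OF assms(1) dequeue.hyps(1)] by blast
  show ?case
  proof (cases "k < length vs")
    case True
    then obtain j where "j < k" "bfs_next E (hd vs) (set (take j vs)) (vs ! j) (set (take k vs)) (vs ! k)"
      using dequeue by blast
    then show ?thesis using True ne by (intro exI[of _ j]) (simp add: nth_append)
  next
    case False
    define i where "i = k - length vs"
    have i: "k = length vs + i" "i < length ws" using False dequeue.prems unfolding i_def by auto
    obtain D where D: "vs = D @ u # q" "set vs = visited_from E (hd vs) (set D)"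
      using bfs_state_invariants[OF assms(1) dequeue.hyps(1)] by blast
    have "distinct (take (Suc i) ws)" using dequeue.hyps by simp
    then have "ws ! i \<notin> set (take i ws)" using i by (simp add: take_Suc_conv_app_nth)
    moreover have "ws ! i \<in> nbrs E u - set vs" using i dequeue.hyps by (metis nth_mem)
    moreover have "set (take i ws) \<subseteq> nbrs E u" using set_take_subset[of i ws] dequeue.hyps by blast
    ultimately have "bfs_next E (hd vs) (set D) u (set vs \<union> set (take i ws)) (ws ! i)"
      unfolding bfs_next_def D(2)[symmetric] by blast
    moreover have "hd (vs @ ws) = hd vs" using ne by simp
    moreover have "set (take (length D) (vs @ ws)) = set D" "(vs @ ws) ! length D = u"
      using D(1) by auto
    moreover have "set (take k (vs @ ws)) = set vs \<union> set (take i ws)" "(vs @ ws) ! k = ws ! i"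
      using i by auto
    ultimately have "bfs_next E (hd (vs @ ws)) (set (take (length D) (vs @ ws))) ((vs @ ws) ! length D)
       (set (take k (vs @ ws))) ((vs @ ws) ! k)" by (simp only:)
    then show ?thesis using i D(1) by (intro exI[of _ "length D"]) auto
  qed
qed simp

lemma bfs_chain_of_state:
  assumes "simple_graph V E" and "bfs_state V E vs q"
  shows "k < length vs \<Longrightarrow> \<exists>i\<le>k. bfs_chain E (hd vs) i (set (take k vs)) (vs ! k)"
proof (induction k rule: less_induct)
  case (less k)
  show ?case
  proof (cases "k = 0")
    case True
    then show ?thesis using less.prems chain_start[of E "hd vs"] by (simp add: hd_conv_nth)
  next
    case False
    then obtain j where j: "j < k"
      "bfs_next E (hd vs) (set (take j vs)) (vs ! j) (set (take k vs)) (vs ! k)"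
      using bfs_state_parent[OF assms] less.prems by blast
    then obtain i where "i \<le> j" "bfs_chain E (hd vs) i (set (take j vs)) (vs ! j)"
      using less.IH[of j] less.prems by auto
    then show ?thesis using chain_step[OF _ j(2)] j(1) by (intro exI[of _ "Suc i"]) auto
  qed
qed

lemma bfs_state_suffix: "bfs_state V E vs q \<Longrightarrow> \<exists>D. vs = D @ q"
proof (induction rule: bfs_state.induct)
  case (dequeue vs u q ws)
  then obtain D where "vs = D @ u # q" by blast
  then have "vs @ ws = (D @ [u]) @ (q @ ws)" by simp
  then show ?case by blast
qed simp

section \<open>Replaying a breadth-first search up to a given vertex\<close>

lemma bfs_state_rewind:
  assumes "bfs_state V E vs q" and "k < length vs - length q"
  shows "\<exists>q'. bfs_state V E (take k vs @ vs ! k # q') (vs ! k # q')"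
  using assms
proof induction
  case (dequeue vs u q ws)
  obtain D where D: "vs = D @ u # q" using bfs_state_suffix[OF dequeue.hyps(1)] by blast
  show ?case
  proof (cases "k = length D")
    case True
    then show ?thesis using dequeue.hyps(1) D by (intro exI[of _ q]) (simp add: nth_append)
  next
    case False
    then have "k < length vs - length (u # q)" using dequeue.prems D by auto
    then obtain q' where "bfs_state V E (take k vs @ vs ! k # q') (vs ! k # q')"
      using dequeue.IH by blast
    moreover have "k < length vs" using \<open>k < length vs - length (u # q)\<close> by simp
    ultimately show ?thesis by (intro exI[of _ q']) (simp add: nth_append)
  qed
qed simp

lemma bfs_state_forward:
  assumes "simple_graph V E"
  shows "bfs_state V E (D @ q) q \<Longrightarrow> i < length q \<Longrightarrow>
    \<exists>q'. bfs_state V E (D @ take i q @ q ! i # q') (q ! i # q')"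
proof (induction i arbitrary: D q)
  case 0
  then show ?case by (intro exI[of _ "tl q"]) (cases q; simp)
next
  case (Suc i)
  obtain u r where q: "q = u # r" using Suc.prems by (cases q) auto
  have "finite (nbrs E u - set (D @ q))"
    using nbrs_subset[OF assms, of u] assms by (auto simp: simple_graph_def intro: finite_subset)
  then obtain ws where ws: "distinct ws" "set ws = nbrs E u - set (D @ q)"
    using finite_distinct_list by metis
  have "bfs_state V E ((D @ q) @ ws) (r @ ws)"
    by (rule bfs_state.dequeue[OF _ ws]) (use Suc.prems q in simp)
  then have "bfs_state V E ((D @ [u]) @ (r @ ws)) (r @ ws)" unfolding q by simp
  from Suc.IH[OF this] show ?case using Suc.prems q by (simp add: nth_append)
qed

text \<open>Every visited vertex is at the front of the queue at some moment: in the past if it has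
  been dequeued, in a suitable continuation otherwise. Neither changes which vertices precede
  it.\<close>

lemma bfs_state_at:
  assumes G: "simple_graph V E" and st: "bfs_state V E vs q" and k: "k < length vs"
  shows "\<exists>q'. bfs_state V E (take k vs @ vs ! k # q') (vs ! k # q')"
proof (cases "k < length vs - length q")
  case True
  then show ?thesis by (rule bfs_state_rewind[OF st])
next
  case False
  obtain D where D: "vs = D @ q" using bfs_state_invariants[OF G st] by blast
  define i where "i = k - length D"
  have i: "k = length D + i" "i < length q" using False k D unfolding i_def by auto
  show ?thesis using bfs_state_forward[OF G st[unfolded D] i(2)] i D by (simp add: nth_append)
qed

definition bfs_prefix :: "'a set \<Rightarrow> 'a set set \<Rightarrow> 'a \<Rightarrow> 'a set \<Rightarrow> 'a \<Rightarrow> bool" where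
  "bfs_prefix V E s T p \<longleftrightarrow>
     (\<exists>vs q k. bfs_state V E vs q \<and> hd vs = s \<and> k < length vs \<and> set (take k vs) = T \<and> vs ! k = p)"

text \<open>When \<open>q\<close> is at the front, the visited set is
  \<open>visited_from E s S\<close>, however \<open>S\<close> was ordered. The new neighbours of
  \<open>q\<close> can then be enqueued with those in \<open>T\<close> first, \<open>p\<close> next
  and the others last.\<close>

lemma bfs_prefix_next:
  assumes G: "simple_graph V E" and "bfs_prefix V E s S q" and nx: "bfs_next E s S q T p"
  shows "bfs_prefix V E s T p"
proof -
  obtain vs r k where vs: "bfs_state V E vs r" "hd vs = s" "k < length vs" "set (take k vs) = S" "vs ! k = q"
    using assms(2) unfolding bfs_prefix_def by blast
  obtain q' where st: "bfs_state V E (take k vs @ q # q') (q # q')"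
    using bfs_state_at[OF G vs(1,3)] vs(5) by blast
  let ?us = "take k vs @ q # q'"
  have hd: "hd (take k vs @ q # zs) = s" for zs using vs(2,3,5) by (cases k; cases vs) auto
  have us: "set ?us = visited_from E s S"
    using bfs_state_invariants[OF G st] hd[of q'] vs(4) by fastforce
  have fin: "finite (nbrs E q)"
    using nbrs_subset[OF G, of q] G by (auto simp: simple_graph_def intro: finite_subset)
  have T: "set ?us \<subseteq> T" "T \<subseteq> set ?us \<union> nbrs E q" "p \<in> nbrs E q" "p \<notin> T"
    using nx unfolding us bfs_next_def by auto
  have "finite (T - set ?us)" using T(2) fin by (auto intro: finite_subset)
  then obtain xs where xs: "distinct xs" "set xs = T - set ?us" using finite_distinct_list by metis
  have "finite (nbrs E q - T - {p})" using fin by simp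
  then obtain ys where ys: "distinct ys" "set ys = nbrs E q - T - {p}" using finite_distinct_list by metis
  have "distinct (xs @ p # ys)" using xs ys T(4) by auto
  moreover have "set (xs @ p # ys) = nbrs E q - set ?us" using xs ys T by auto
  ultimately have "bfs_state V E (?us @ xs @ p # ys) (q' @ xs @ p # ys)"
    by (rule bfs_state.dequeue[OF st])
  moreover have "hd (?us @ xs @ p # ys) = s" using hd[of "q' @ xs @ p # ys"] by simp
  moreover have "set (take (length (?us @ xs)) (?us @ xs @ p # ys)) = T"
  proof -
    have "take (length (us @ xs)) (us @ xs @ p # ys) = us @ xs" for us by simp
    then show ?thesis using xs(2) T(1) by (simp only: set_append) blast
  qed
  moreover have "(?us @ xs @ p # ys) ! length (?us @ xs) = p"
    using nth_append_length[of "?us @ xs" p ys] by (simp only: append_assoc)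
  moreover have "length (?us @ xs) < length (?us @ xs @ p # ys)" by simp
  ultimately show ?thesis
    unfolding bfs_prefix_def
    by (intro exI[of _ "?us @ xs @ p # ys"] exI[of _ "q' @ xs @ p # ys"] exI[of _ "length (?us @ xs)"] conjI)
qed

lemma bfs_prefix_of_chain:
  assumes "simple_graph V E" and "s \<in> V"
  shows "bfs_chain E s i T p \<Longrightarrow> bfs_prefix V E s T p"
proof (induction rule: bfs_chain.induct)
  case chain_start
  then show ?case
    unfolding bfs_prefix_def using bfs_state.start[OF assms(2)]
    by (intro exI[of _ "[s]"] exI[of _ "[s]"] exI[of _ 0]) simp
next
  case (chain_step i S q T p)
  then show ?case using bfs_prefix_next[OF assms(1)] by blast
qed

lemma bfs_state_finish:
  assumes "simple_graph V E" and "bfs_state V E vs q" and "set vs = V"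
  shows "bfs_state V E vs []"
  using assms(2)
proof (induction q rule: list.induct)
  case (Cons u q)
  have "set [] = nbrs E u - set vs" using nbrs_subset[OF assms(1), of u] assms(3) by auto
  from bfs_state.dequeue[OF Cons.prems _ this] show ?case using Cons.IH by simp
qed

text \<open>A chain moves from a vertex to its discoverer's successor in visiting order, so its
  length is at most the position of \<open>z\<close>. This limits how many layers the program has to
  tabulate.\<close>

lemma bfs_chain_of_end_vertex:
  assumes G: "simple_graph V E" and "is_end_vertex (bfs_ordering V E) z"
  shows "\<exists>s\<in>V. \<exists>i<card V. bfs_chain E s i (V - {z}) z"
proof -
  obtain vs where vs: "bfs_state V E vs []" "set vs = V" "vs \<noteq> []" "last vs = z"
    using assms(2) unfolding is_end_vertex_def bfs_ordering_def by blast
  then obtain us where us: "vs = us @ [z]" by (metis append_butlast_last_id)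
  have d: "distinct vs" using bfs_state_invariants[OF G vs(1)] by blast
  have len: "length us < card V" using d vs(2) distinct_card[OF d] us by simp
  obtain i where "i \<le> length us" "bfs_chain E (hd vs) i (set (take (length us) vs)) (vs ! length us)"
    using bfs_chain_of_state[OF G vs(1), of "length us"] us by auto
  moreover have "set (take (length us) vs) = V - {z}" "vs ! length us = z"
    using us vs(2) d by auto
  moreover have "hd vs \<in> V" using vs(2,3) by auto
  ultimately show ?thesis
    using len by (intro bexI[of _ "hd vs"] exI[of _ i]) auto
qed

lemma end_vertex_of_bfs_chain:
  assumes G: "simple_graph V E" and z: "z \<in> V" and "s \<in> V" and "bfs_chain E s i (V - {z}) z"
  shows "is_end_vertex (bfs_ordering V E) z"
proof -
  obtain vs q k where vs: "bfs_state V E vs q" "k < length vs" "set (take k vs) = V - {z}" "vs ! k = z"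
    using bfs_prefix_of_chain[OF G assms(3,4)] unfolding bfs_prefix_def by blast
  have inv: "distinct vs" "set vs \<subseteq> V" using bfs_state_invariants[OF G vs(1)] by auto
  have V: "set (take (Suc k) vs) = V" using vs z by (simp add: take_Suc_conv_app_nth) auto
  then have "set vs = V" using inv(2) set_take_subset[of "Suc k" vs] by blast
  have "card (set (take (Suc k) vs)) = card (set vs)" using V \<open>set vs = V\<close> by simp
  then have "length vs = Suc k"
    using inv(1) vs(2) by (simp add: distinct_card)
  then have "last vs = z" using vs(4) by (cases vs) (auto simp: last_conv_nth)
  moreover have "vs \<noteq> []" using vs(2) by auto
  ultimately show ?thesis
    using bfs_state_finish[OF G vs(1) \<open>set vs = V\<close>] \<open>set vs = V\<close>
    unfolding is_end_vertex_def bfs_ordering_def by blast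
qed

text \<open>\<open>layers E s i\<close> consists of the vertices at distance less than \<open>i\<close> from \<open>s\<close>.\<close>

fun layers :: "'a set set \<Rightarrow> 'a \<Rightarrow> nat \<Rightarrow> 'a set" where
  "layers E s 0 = {}"
| "layers E s (Suc i) = visited_from E s (layers E s i)"

lemma layers_subset: "simple_graph V E \<Longrightarrow> s \<in> V \<Longrightarrow> layers E s i \<subseteq> V"
  by (induction i) (auto simp: visited_from_def dest: nbrs_subset)

text \<open>\<open>visited_from\<close> is monotone and maps each layer set to the next, so one step
  of a chain shifts both bounds by one.\<close>

lemma bfs_chain_layers:
  "bfs_chain E s i T p \<Longrightarrow>
    layers E s i \<subseteq> T \<and> T \<subseteq> layers E s (Suc i) \<and> p \<in> layers E s (Suc i)"
proof (induction rule: bfs_chain.induct)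
  case chain_start
  then show ?case by (simp add: visited_from_def)
next
  case (chain_step i S q T p)
  have "visited_from E s (layers E s i) \<subseteq> visited_from E s S"
    using chain_step.IH by (intro visited_from_mono) blast
  moreover have "visited_from E s (insert q S) \<subseteq> visited_from E s (layers E s (Suc i))"
    using chain_step.IH by (intro visited_from_mono) blast
  ultimately show ?case using chain_step.hyps(2) unfolding bfs_next_def visited_from_insert by auto
qed

text \<open>Array 5 stores the layers: bit \<open>(s, i, v)\<close> tells whether \<open>v\<close> is in \<open>layers E s i\<close>.  Array 6
  stores the chains: bit \<open>(s, T, p)\<close> is set if \<open>bfs_chain E s i T p\<close> for some \<open>i > 0\<close>.\<close>

definition layer_tm :: "tm \<Rightarrow> tm \<Rightarrow> tm" where
  "layer_tm i v = Get 5 (pair_tm (pair_tm (Var 0) i) v)"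

definition layer_step_tm :: tm where
  "layer_step_tm = disj_tm (Op Equal (Var 2) (Var 0))
     (ex_tm False 3 (conj_tm (layer_tm (Var 1) (Var 3)) (adj_tm (Var 3) (Var 2))))"

definition layers_stm :: stm where
  "layers_stm = For False 0 (For False 1 (For False 2
     (Asg 5 (pair_tm (pair_tm (Var 0) (Op Plus (Var 1) (Num 1))) (Var 2)) layer_step_tm)))"

definition layer_ok :: "nat set set \<Rightarrow> nat \<Rightarrow> memory \<Rightarrow> nat \<Rightarrow> nat \<Rightarrow> nat \<Rightarrow> bool" where
  "layer_ok E n m s i v \<longleftrightarrow> (m 5 ((s * 2 ^ n + i) * 2 ^ n + v) \<noteq> 0 \<longleftrightarrow> v \<in> layers E s i)"

lemma le_imp_less_power: "i \<le> n \<Longrightarrow> i < 2 ^ n"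
  using less_exp[of n] by linarith

lemma holds_layer_step_tm:
  assumes m: "inputs n E z m" and E: "simple_graph {..<n} E"
    and \<rho>: "\<rho> 0 = s" "\<rho> 1 = i" "\<rho> 2 = v" "s < n" "v < n"
    and ok: "\<forall>w<n. layer_ok E n m s i w"
  shows "holds layer_step_tm \<rho> m \<longleftrightarrow> v \<in> layers E s (Suc i)"
proof -
  have "holds layer_step_tm \<rho> m \<longleftrightarrow> v = s \<or> (\<exists>w<n. w \<in> layers E s i \<and> {w, v} \<in> E)"
    using \<rho> ok unfolding layer_ok_def
    by (simp add: layer_step_tm_def layer_tm_def holds_simps holds_quantifiers[OF m] tval_adj[OF m]
        tval_pair[OF m] cong: conj_cong)
  moreover have "layers E s i \<subseteq> {..<n}" using layers_subset[OF E] \<rho>(4) by simp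
  ultimately show ?thesis by (auto simp: visited_from_def nbrs_def)
qed

lemma layer_ok_update:
  assumes "layer_ok E n m s' i' v'" and "i \<le> n" "i' \<le> n" "v < n" "v' < n"
    and "b \<longleftrightarrow> v \<in> layers E s i"
  shows "layer_ok E n (m(5 := (m 5)((s * 2 ^ n + i) * 2 ^ n + v := of_bool b))) s' i' v'"
proof -
  have "(s' * 2 ^ n + i') * 2 ^ n + v' = (s * 2 ^ n + i) * 2 ^ n + v \<longleftrightarrow> s' = s \<and> i' = i \<and> v' = v"
    using assms by (simp add: pair_eq_iff le_imp_less_power)
  then show ?thesis using assms(1,6) by (auto simp: layer_ok_def)
qed

lemma layer_ok_new:
  "b \<longleftrightarrow> v \<in> layers E s i \<Longrightarrow>
    layer_ok E n (m(5 := (m 5)((s * 2 ^ n + i) * 2 ^ n + v := of_bool b))) s i v"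
  by (simp add: layer_ok_def)

lemma run_layers_stm:
  assumes m0: "inputs n E z m0" and E: "simple_graph {..<n} E" and "m0 5 = (\<lambda>_. 0)"
  shows "\<forall>s<n. \<forall>i\<le>n. \<forall>v<n. layer_ok E n (run layers_stm \<rho> m0) s i v"
proof -
  let ?p = "Asg 5 (pair_tm (pair_tm (Var 0) (Op Plus (Var 1) (Num 1))) (Var 2)) layer_step_tm"
  define ok where "ok = (\<lambda>A m. inputs n E z m \<and> (\<forall>s<n. \<forall>i\<le>n. \<forall>v<n. A s i v \<longrightarrow> layer_ok E n m s i v))"
  have ok_mono: "ok B m" if "ok A m" "\<And>s i v. s < n \<Longrightarrow> i \<le> n \<Longrightarrow> v < n \<Longrightarrow> B s i v \<Longrightarrow> A s i v" for A B m
    using that unfolding ok_def by blast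
  have bnd: "bound False m = n" if "ok A m" for A m
    using that inputs_simps(5)[of n E z m False] unfolding ok_def by simp
  \<comment> \<open>The predicates list the triples known to be correct so far. Row 0 is correct
    from the start, since zero cells code the empty set; the loops fill row \<open>Suc i\<close>
    from row \<open>i\<close>.\<close>
  let ?A0 = "\<lambda>k s i v. s < k \<or> i = 0"
  let ?A1 = "\<lambda>s' k s i v. s < s' \<or> i = 0 \<or> s = s' \<and> i \<le> (k::nat)"
  let ?A2 = "\<lambda>s' i' k s i v. ?A1 s' i' s i v \<or> s = s' \<and> i = Suc i' \<and> v < (k::nat)"
  have "ok (?A0 n) (run layers_stm \<rho> m0)"
    unfolding layers_stm_def
  proof (rule run_For[where I = "\<lambda>k. ok (?A0 k)"])
    show 0: "ok (?A0 0) m0" using m0 assms(3) by (simp add: ok_def layer_ok_def)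
    show "bound False m0 = n" using bnd[OF 0] .
    fix s m assume s: "s < n" and m: "ok (?A0 s) m"
    have "ok (?A1 s n) (run (For False 1 (For False 2 ?p)) (\<rho>(0 := s)) m)"
    proof (rule run_For[where I = "\<lambda>k. ok (?A1 s k)"])
      show "ok (?A1 s 0) m" using m by (rule ok_mono) auto
      show "bound False m = n" using bnd[OF m] .
      fix i m assume i: "i < n" and m: "ok (?A1 s i) m"
      have "ok (?A2 s i n) (run (For False 2 ?p) (\<rho>(0 := s, 1 := i)) m)"
      proof (rule run_For[where I = "\<lambda>k. ok (?A2 s i k)"])
        show "ok (?A2 s i 0) m" using m by (rule ok_mono) auto
        show "bound False m = n" using bnd[OF m] .
        fix v m assume v: "v < n" and m: "ok (?A2 s i v) m"
        let ?\<rho> = "\<rho>(0 := s, 1 := i, 2 := v)" and ?b = "v \<in> layers E s (Suc i)"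
        have in_m: "inputs n E z m" using m unfolding ok_def by blast
        have "\<forall>w<n. layer_ok E n m s i w" using m s i unfolding ok_def by auto
        then have "holds layer_step_tm ?\<rho> m \<longleftrightarrow> ?b"
          using s v by (intro holds_layer_step_tm[OF in_m E]) auto
        then have run: "run ?p ?\<rho> m = m(5 := (m 5)((s * 2 ^ n + Suc i) * 2 ^ n + v := of_bool ?b))"
          by (simp add: tval_pair[OF in_m] holds_def)
        show "ok (?A2 s i (Suc v)) (run ?p ?\<rho> m)"
          unfolding ok_def
        proof (intro conjI allI impI)
          show "inputs n E z (run ?p ?\<rho> m)" unfolding run by (rule inputs_upd[OF in_m]) simp
          fix s' i' v' assume b: "s' < n" "i' \<le> n" "v' < n" "?A2 s i (Suc v) s' i' v'"
          show "layer_ok E n (run ?p ?\<rho> m) s' i' v'"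
          proof (cases "s' = s \<and> i' = Suc i \<and> v' = v")
            case True
            moreover have "layer_ok E n (run ?p ?\<rho> m) s (Suc i) v"
              unfolding run by (rule layer_ok_new) (rule refl)
            ultimately show ?thesis by (simp only:)
          next
            case False
            then have "layer_ok E n m s' i' v'" using m b unfolding ok_def by (auto simp: less_Suc_eq)
            then show ?thesis unfolding run using b i v by (intro layer_ok_update) auto
          qed
        qed
      qed
      then show "ok (?A1 s (Suc i)) (run (For False 2 ?p) (\<rho>(0 := s, 1 := i)) m)"
        by (rule ok_mono) (auto simp: le_Suc_eq)
    qed
    then show "ok (?A0 (Suc s)) (run (For False 1 (For False 2 ?p)) (\<rho>(0 := s)) m)"
      by (rule ok_mono) (auto simp: less_Suc_eq)
  qed
  then show ?thesis unfolding ok_def by simp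
qed

section \<open>The program for chains\<close>

text \<open>Computes the code of a vertex set from a membership test in polynomially many
  evaluations of that test. \<open>S\<close> and \<open>T\<close> are obtained this way instead of
  by further loops over subsets.\<close>

definition mask_tm :: "nat \<Rightarrow> tm \<Rightarrow> tm" where
  "mask_tm x t = Sum False x (conj_tm (Op Less (Num 0) t) (pow_tm (Var x)))"

lemma tval_mask:
  assumes "inputs n E z m"
  shows "tval (mask_tm x t) \<rho> m = set_encode {v. v < n \<and> holds t (\<rho>(x := v)) m}"
proof -
  have "tval (mask_tm x t) \<rho> m = (\<Sum>v<n. if holds t (\<rho>(x := v)) m then 2 ^ v else 0)"
    unfolding mask_tm_def tval.simps inputs_simps(5)[OF assms]
    by (intro sum.cong) (auto simp: conj_tm_def holds_def tval_input_tms[OF assms])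
  also have "\<dots> = sum ((^) 2) {v. v < n \<and> holds t (\<rho>(x := v)) m}"
    by (simp add: sum.If_cases Int_def)
  finally show ?thesis by (simp add: set_encode_def)
qed

definition source_tm :: "tm \<Rightarrow> tm" where
  "source_tm v = disj_tm (layer_tm (Var 1) v)
     (conj_tm (layer_tm (Op Plus (Var 1) (Num 1)) v) (mem_tm v (Var 2)))"

definition target_tm :: "tm \<Rightarrow> tm" where
  "target_tm v = disj_tm (layer_tm (Op Plus (Var 1) (Num 1)) v)
     (conj_tm (layer_tm (Op Plus (Var 1) (Num 2)) v) (mem_tm v (Var 2)))"

definition visited_tm :: tm where
  "visited_tm = disj_tm (Op Equal (Var 5) (Var 0))
     (ex_tm False 6 (conj_tm (source_tm (Var 6)) (adj_tm (Var 6) (Var 5))))"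

definition next_tm :: tm where
  "next_tm = conj_tm (conj_tm
     (all_tm False 5 (disj_tm (not_tm visited_tm) (target_tm (Var 5))))
     (all_tm False 5 (disj_tm (not_tm (target_tm (Var 5))) (disj_tm visited_tm (adj_tm (Var 3) (Var 5))))))
     (conj_tm (adj_tm (Var 3) (Var 4)) (not_tm (target_tm (Var 4))))"

definition key_tm :: "tm \<Rightarrow> tm \<Rightarrow> tm" where
  "key_tm t p = pair_tm (pair_tm (Var 0) t) p"

text \<open>The chain of length 0 is recognized here instead of being stored, so the table can start
  with zeros.\<close>

definition entry_tm :: "tm \<Rightarrow> tm \<Rightarrow> tm" where
  "entry_tm t p = disj_tm (Get 6 (key_tm t p)) (conj_tm (Op Equal t (Num 0)) (Op Equal p (Var 0)))"

text \<open>Several choices of mask and \<open>q\<close> can lead to the same key, so the old bit is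
  kept by a disjunction.\<close>

definition chain_body :: stm where
  "chain_body = Asg 6 (key_tm (mask_tm 5 (target_tm (Var 5))) (Var 4))
     (disj_tm (Get 6 (key_tm (mask_tm 5 (target_tm (Var 5))) (Var 4)))
        (conj_tm (entry_tm (mask_tm 5 (source_tm (Var 5))) (Var 3)) next_tm))"

definition chain_stm :: stm where
  "chain_stm = For False 0 (For False 1 (For True 2 (For False 3 (For False 4 chain_body))))"

definition row :: "nat \<Rightarrow> memory \<Rightarrow> nat \<Rightarrow> nat \<Rightarrow> nat set" where
  "row n m s i = {v. v < n \<and> m 5 ((s * 2 ^ n + i) * 2 ^ n + v) \<noteq> 0}"

definition blend :: "nat set \<Rightarrow> nat set \<Rightarrow> nat \<Rightarrow> nat set" where
  "blend A B k = A \<union> (B \<inter> set_decode k)"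

definition key :: "nat \<Rightarrow> nat \<Rightarrow> nat set \<Rightarrow> nat \<Rightarrow> nat" where
  "key n s T p = (s * 2 ^ n + set_encode T) * 2 ^ n + p"

lemma row_subset: "row n m s i \<subseteq> {..<n}"
  by (auto simp: row_def)

lemma blend_subset: "A \<subseteq> V \<Longrightarrow> B \<subseteq> V \<Longrightarrow> blend A B k \<subseteq> V"
  by (auto simp: blend_def)

lemma set_encode_less: "T \<subseteq> {..<n} \<Longrightarrow> set_encode T < 2 ^ n"
  using set_decode_subset[of "set_encode T" n] finite_subset[of T "{..<n}"] by simp

lemma key_eq_iff:
  assumes "T \<subseteq> {..<n}" "T' \<subseteq> {..<n}" "p < n" "p' < n"
  shows "key n s T p = key n s' T' p' \<longleftrightarrow> s = s' \<and> T = T' \<and> p = p'"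
proof -
  have "set_encode T = set_encode T' \<longleftrightarrow> T = T'"
    using set_encode_eq[of T T'] finite_subset[OF assms(1)] finite_subset[OF assms(2)] by simp
  then show ?thesis
    using assms unfolding key_def by (simp add: pair_eq_iff le_imp_less_power set_encode_less)
qed

context
  fixes n z s i k q p :: nat and E :: "nat set set" and m :: memory and \<rho> :: "nat \<Rightarrow> nat"
    and S T :: "nat set"
  assumes m: "inputs n E z m" and E: "simple_graph {..<n} E"
    and \<rho>: "\<rho> 0 = s" "\<rho> 1 = i" "\<rho> 2 = k" "\<rho> 3 = q" "\<rho> 4 = p"
    and bounds: "s < n" "q < n" "p < n"
  defines "S \<equiv> blend (row n m s i) (row n m s (i + 1)) k"
    and "T \<equiv> blend (row n m s (i + 1)) (row n m s (i + 2)) k"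
begin

lemma S_subset: "S \<subseteq> {..<n}" and T_subset: "T \<subseteq> {..<n}"
  unfolding S_def T_def by (simp_all add: blend_subset row_subset)

lemma holds_source: "v < n \<Longrightarrow> tval t \<rho>' m = v \<Longrightarrow> \<forall>j\<le>2. \<rho>' j = \<rho> j \<Longrightarrow>
    holds (source_tm t) \<rho>' m \<longleftrightarrow> v \<in> S"
  using \<rho> by (simp add: source_tm_def layer_tm_def S_def blend_def row_def holds_simps tval_mem[OF m]
      tval_pair[OF m])

lemma holds_target: "v < n \<Longrightarrow> tval t \<rho>' m = v \<Longrightarrow> \<forall>j\<le>2. \<rho>' j = \<rho> j \<Longrightarrow>
    holds (target_tm t) \<rho>' m \<longleftrightarrow> v \<in> T"
  using \<rho> by (simp add: target_tm_def layer_tm_def T_def blend_def row_def holds_simps tval_mem[OF m]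
      tval_pair[OF m])

lemma tval_source_mask: "tval (mask_tm 5 (source_tm (Var 5))) \<rho> m = set_encode S"
proof -
  have "{v. v < n \<and> holds (source_tm (Var 5)) (\<rho>(5 := v)) m} = S"
    using S_subset by (auto simp: holds_source)
  then show ?thesis by (simp add: tval_mask[OF m])
qed

lemma tval_target_mask: "tval (mask_tm 5 (target_tm (Var 5))) \<rho> m = set_encode T"
proof -
  have "{v. v < n \<and> holds (target_tm (Var 5)) (\<rho>(5 := v)) m} = T"
    using T_subset by (auto simp: holds_target)
  then show ?thesis by (simp add: tval_mask[OF m])
qed

lemma holds_visited:
  assumes "v < n"
  shows "holds visited_tm (\<rho>(5 := v)) m \<longleftrightarrow> v \<in> visited_from E s S"
proof -
  have "holds visited_tm (\<rho>(5 := v)) m \<longleftrightarrow> v = s \<or> (\<exists>w<n. w \<in> S \<and> {w, v} \<in> E)"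
    using assms \<rho>(1) by (simp add: visited_tm_def holds_simps holds_quantifiers[OF m] holds_source
        tval_adj[OF m] cong: conj_cong)
  then show ?thesis using S_subset by (auto simp: visited_from_def nbrs_def)
qed

lemma holds_next: "holds next_tm \<rho> m \<longleftrightarrow> bfs_next E s S q T p"
proof -
  have "visited_from E s S \<subseteq> {..<n}"
    using nbrs_subset[OF E] bounds by (auto simp: visited_from_def)
  moreover have "holds next_tm \<rho> m \<longleftrightarrow> (\<forall>v<n. v \<notin> visited_from E s S \<or> v \<in> T) \<and>
      (\<forall>v<n. v \<notin> T \<or> v \<in> visited_from E s S \<or> {q, v} \<in> E) \<and> {q, p} \<in> E \<and> p \<notin> T"
    using bounds \<rho> by (simp add: next_tm_def holds_simps holds_quantifiers[OF m] holds_target holds_visited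
        tval_adj[OF m] cong: conj_cong disj_cong)
  ultimately show ?thesis
    using T_subset unfolding bfs_next_def nbrs_def by blast
qed

lemma run_chain_body:
  "run chain_body \<rho> m = m(6 := (m 6)(key n s T p := of_bool (m 6 (key n s T p) \<noteq> 0 \<or>
     (m 6 (key n s S q) \<noteq> 0 \<or> S = {} \<and> q = s) \<and> bfs_next E s S q T p)))"
proof -
  have "set_encode S = 0 \<longleftrightarrow> S = {}"
    using set_encode_eq[of S "{}"] finite_subset[OF S_subset] by simp
  then have "holds (entry_tm (mask_tm 5 (source_tm (Var 5))) (Var 3)) \<rho> m \<longleftrightarrow>
      m 6 (key n s S q) \<noteq> 0 \<or> S = {} \<and> q = s"
    using \<rho> by (simp add: entry_tm_def key_tm_def key_def holds_simps tval_pair[OF m] tval_source_mask)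
  moreover have "tval (key_tm (mask_tm 5 (target_tm (Var 5))) (Var 4)) \<rho> m = key n s T p"
    using \<rho> by (simp add: key_tm_def key_def tval_pair[OF m] tval_target_mask)
  ultimately show ?thesis
    unfolding chain_body_def run.simps holds_def[symmetric]
    by (simp add: holds_simps holds_next)
qed

end

section \<open>Soundness and completeness of the chain table\<close>

text \<open>Bits are only ever switched on, so the contributions of the rounds accumulate and a loop
  collects their union in whatever order the rounds come.\<close>

definition collects :: "(memory \<Rightarrow> bool) \<Rightarrow> nat set \<Rightarrow> (memory \<Rightarrow> memory) \<Rightarrow> bool" where
  "collects I X f \<longleftrightarrow> (\<forall>m. I m \<longrightarrow> I (f m) \<and> (\<forall>x. m 6 x \<noteq> 0 \<longrightarrow> f m 6 x \<noteq> 0) \<and> (\<forall>x\<in>X. f m 6 x \<noteq> 0))"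

lemma collectsD:
  assumes "collects I X f" and "I m"
  shows "I (f m)" and "m 6 x \<noteq> 0 \<Longrightarrow> f m 6 x \<noteq> 0" and "x \<in> X \<Longrightarrow> f m 6 x \<noteq> 0"
  using assms unfolding collects_def by simp_all

lemma collects_For:
  assumes "\<And>m. I m \<Longrightarrow> bound b m = N" and "\<And>i. i < N \<Longrightarrow> collects I (X i) (run p (\<rho>(v := i)))"
  shows "collects I (\<Union>i<N. X i) (run (For b v p) \<rho>)"
  unfolding collects_def
proof (intro allI impI)
  fix m assume m: "I m"
  have "I (run (For b v p) \<rho> m) \<and> (\<forall>x. m 6 x \<noteq> 0 \<longrightarrow> run (For b v p) \<rho> m 6 x \<noteq> 0) \<and>
      (\<forall>j<N. \<forall>x\<in>X j. run (For b v p) \<rho> m 6 x \<noteq> 0)"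
  proof (rule run_For[where I = "\<lambda>i m'. I m' \<and> (\<forall>x. m 6 x \<noteq> 0 \<longrightarrow> m' 6 x \<noteq> 0) \<and>
      (\<forall>j<i. \<forall>x\<in>X j. m' 6 x \<noteq> 0)"])
    show "bound b m = N" using assms(1) m .
    fix i m' assume i: "i < N" and m': "I m' \<and> (\<forall>x. m 6 x \<noteq> 0 \<longrightarrow> m' 6 x \<noteq> 0) \<and>
      (\<forall>j<i. \<forall>x\<in>X j. m' 6 x \<noteq> 0)"
    let ?m = "run p (\<rho>(v := i)) m'"
    have new: "I ?m" "\<And>x. m' 6 x \<noteq> 0 \<Longrightarrow> ?m 6 x \<noteq> 0" "\<And>x. x \<in> X i \<Longrightarrow> ?m 6 x \<noteq> 0"
      using collectsD[OF assms(2)[OF i]] m' by blast+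
    show "I ?m \<and> (\<forall>x. m 6 x \<noteq> 0 \<longrightarrow> ?m 6 x \<noteq> 0) \<and> (\<forall>j<Suc i. \<forall>x\<in>X j. ?m 6 x \<noteq> 0)"
    proof (intro conjI allI impI ballI)
      fix j x assume "j < Suc i" "x \<in> X j"
      then have "j = i \<or> j < i" by (simp add: less_Suc_eq disj_commute)
      then have "j = i \<or> m' 6 x \<noteq> 0" using m' \<open>x \<in> X j\<close> by blast
      then show "?m 6 x \<noteq> 0" using new(2,3) \<open>x \<in> X j\<close> by blast
    qed (use new m' in blast)+
  qed (use m in auto)
  then show "I (run (For b v p) \<rho> m) \<and> (\<forall>x. m 6 x \<noteq> 0 \<longrightarrow> run (For b v p) \<rho> m 6 x \<noteq> 0) \<and>
      (\<forall>x\<in>(\<Union>j<N. X j). run (For b v p) \<rho> m 6 x \<noteq> 0)" by blast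
qed

lemma collects_subset: "collects I X f \<Longrightarrow> Y \<subseteq> X \<Longrightarrow> collects I Y f"
  unfolding collects_def by blast

text \<open>The soundness half: a set bit certifies a chain of some length, which the key does not
  record.\<close>

definition chain_inv :: "nat \<Rightarrow> nat set set \<Rightarrow> nat \<Rightarrow> memory \<Rightarrow> bool" where
  "chain_inv n E z m \<longleftrightarrow> inputs n E z m \<and> (\<forall>s<n. \<forall>i\<le>n. row n m s i = layers E s i) \<and>
     (\<forall>s<n. \<forall>T\<subseteq>{..<n}. \<forall>p<n. m 6 (key n s T p) \<noteq> 0 \<longrightarrow> (\<exists>i. bfs_chain E s i T p))"

definition chain_keys :: "nat \<Rightarrow> nat set set \<Rightarrow> nat \<Rightarrow> nat \<Rightarrow> nat set" where
  "chain_keys n E s i = {key n s T p |T p. i < n \<and> bfs_chain E s i T p}"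

text \<open>The completeness half, by chain length. Length 0 is left to
  \<open>entry_tm\<close>.\<close>

definition complete_upto :: "nat \<Rightarrow> nat set set \<Rightarrow> nat \<Rightarrow> nat \<Rightarrow> memory \<Rightarrow> bool" where
  "complete_upto n E s k m \<longleftrightarrow> (\<forall>i\<in>{0<..k}. \<forall>x\<in>chain_keys n E s i. m 6 x \<noteq> 0)"

lemma bfs_chain_bounds:
  assumes "simple_graph {..<n} E" and "s < n" and "bfs_chain E s i T p"
  shows "T \<subseteq> {..<n}" and "p < n"
proof -
  have "layers E s (Suc i) \<subseteq> {..<n}"
    using layers_subset[OF assms(1), of s "Suc i"] assms(2) by (simp del: layers.simps)
  then show "T \<subseteq> {..<n}" "p < n" using bfs_chain_layers[OF assms(3)] by auto
qed

lemma bfs_chain_0: "bfs_chain E s 0 T p \<longleftrightarrow> T = {} \<and> p = s"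
  by (subst bfs_chain.simps) simp

text \<open>Soundness concerns the sets \<open>S'\<close> and \<open>T'\<close> that are really
  decoded from the table, whatever the rows contain, because the step between them is tested by the
  program. Completeness is claimed only for \<open>i + 1 < n\<close>, where row \<open>i + 2\<close>
  is among those known to be correct. The comprehension over \<open>unit\<close> is a set of at most
  one key, empty if its condition fails.\<close>

lemma chain_body_collects:
  assumes E: "simple_graph {..<n} E" and bounds: "s < n" "i < n" "k < 2 ^ n" "q < n" "p < n"
  defines "S \<equiv> blend (layers E s i) (layers E s (i + 1)) k"
    and "T \<equiv> blend (layers E s (i + 1)) (layers E s (i + 2)) k"
  shows "collects (\<lambda>m. chain_inv n E z m \<and> complete_upto n E s i m)
    {key n s T p |_::unit. i + 1 < n \<and> bfs_chain E s i S q \<and> bfs_next E s S q T p}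
    (run chain_body (\<rho>(0 := s, 1 := i, 2 := k, 3 := q, 4 := p)))"
  unfolding collects_def
proof (intro allI impI)
  fix m assume "chain_inv n E z m \<and> complete_upto n E s i m"
  then have inp: "inputs n E z m" and rows: "\<forall>s<n. \<forall>i\<le>n. row n m s i = layers E s i"
    and sound: "\<forall>s<n. \<forall>T\<subseteq>{..<n}. \<forall>p<n. m 6 (key n s T p) \<noteq> 0 \<longrightarrow> (\<exists>i. bfs_chain E s i T p)"
    and compl: "complete_upto n E s i m"
    unfolding chain_inv_def by blast+
  let ?\<rho> = "\<rho>(0 := s, 1 := i, 2 := k, 3 := q, 4 := p)"
  define S' where "S' = blend (row n m s i) (row n m s (i + 1)) k"
  define T' where "T' = blend (row n m s (i + 1)) (row n m s (i + 2)) k"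
  define b where "b \<longleftrightarrow> m 6 (key n s T' p) \<noteq> 0 \<or>
     (m 6 (key n s S' q) \<noteq> 0 \<or> S' = {} \<and> q = s) \<and> bfs_next E s S' q T' p"
  have run: "run chain_body ?\<rho> m = m(6 := (m 6)(key n s T' p := of_bool b))"
    unfolding b_def S'_def T'_def using bounds by (intro run_chain_body[OF inp E]) auto
  have sub: "S' \<subseteq> {..<n}" "T' \<subseteq> {..<n}"
    unfolding S'_def T'_def by (simp_all add: blend_subset row_subset)
  have b_chain: "\<exists>i. bfs_chain E s i T' p" if b
  proof (cases "m 6 (key n s T' p) \<noteq> 0")
    case True
    then show ?thesis using sound sub bounds by blast
  next
    case False
    then have nx: "bfs_next E s S' q T' p" and "m 6 (key n s S' q) \<noteq> 0 \<or> S' = {} \<and> q = s"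
      using that unfolding b_def by blast+
    then have "\<exists>i. bfs_chain E s i S' q"
      using sound sub bounds chain_start[of E s] by blast
    then show ?thesis using chain_step[OF _ nx] by blast
  qed
  have mono: "run chain_body ?\<rho> m 6 x \<noteq> 0" if "m 6 x \<noteq> 0" for x
    using that unfolding run b_def by auto
  have "chain_inv n E z (run chain_body ?\<rho> m)"
    unfolding chain_inv_def
  proof (intro conjI allI impI)
    show "inputs n E z (run chain_body ?\<rho> m)" unfolding run by (rule inputs_upd[OF inp]) simp
    show "row n (run chain_body ?\<rho> m) s i = layers E s i" if "s < n" "i \<le> n" for s i
      using rows that unfolding run row_def by simp
    fix s' U p' assume U: "s' < n" "U \<subseteq> {..<n}" "p' < n" "run chain_body ?\<rho> m 6 (key n s' U p') \<noteq> 0"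
    show "\<exists>i. bfs_chain E s' i U p'"
    proof (cases "key n s' U p' = key n s T' p")
      case True
      then have "b" using U(4) unfolding run by (auto split: if_splits)
      moreover have "s' = s" "U = T'" "p' = p"
        using True key_eq_iff[OF U(2) sub(2) U(3) bounds(5)] by auto
      ultimately show ?thesis using b_chain by simp
    next
      case False
      then have "m 6 (key n s' U p') \<noteq> 0" using U(4) unfolding run by simp
      then show ?thesis using sound U(1-3) by blast
    qed
  qed
  moreover have "complete_upto n E s i (run chain_body ?\<rho> m)"
    using compl mono unfolding complete_upto_def by blast
  moreover have "run chain_body ?\<rho> m 6 (key n s T p) \<noteq> 0"
    if new: "i + 1 < n" "bfs_chain E s i S q" "bfs_next E s S q T p"
  proof -
    have eq: "S' = S" "T' = T"
      using rows bounds new(1) unfolding S_def T_def S'_def T'_def by simp_all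
    have "m 6 (key n s S q) \<noteq> 0 \<or> S = {} \<and> q = s"
    proof (cases "i = 0")
      case True
      then show ?thesis using new(2) by (simp add: bfs_chain_0)
    next
      case False
      then have "key n s S q \<in> chain_keys n E s i" using new bounds unfolding chain_keys_def by blast
      moreover have "i \<in> {0<..i}" using False by simp
      ultimately show ?thesis using compl unfolding complete_upto_def by blast
    qed
    then have b using new(3) unfolding b_def eq by blast
    then show ?thesis unfolding run eq by simp
  qed
  ultimately show "(chain_inv n E z (run chain_body ?\<rho> m) \<and> complete_upto n E s i (run chain_body ?\<rho> m)) \<and>
      (\<forall>x. m 6 x \<noteq> 0 \<longrightarrow> run chain_body ?\<rho> m 6 x \<noteq> 0) \<and>
      (\<forall>x\<in>{key n s T p |_::unit. i + 1 < n \<and> bfs_chain E s i S q \<and> bfs_next E s S q T p}.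
         run chain_body ?\<rho> m 6 x \<noteq> 0)"
    using mono by blast
qed

text \<open>Since \<open>S\<close> and \<open>T\<close> lie between consecutive layers, the pair \<open>(S, T)\<close> is encoded by the
  single set \<open>(S - L\<^sub>i) \<union> (T - L\<^sub>i\<^sub>+\<^sub>1)\<close>.  This keeps the enumeration within \<open>2\<^sup>n\<close> steps.\<close>

lemma chain_pair_mask:
  assumes E: "simple_graph {..<n} E" and s: "s < n"
    and S: "bfs_chain E s i S q" and T: "bfs_next E s S q T p"
  shows "\<exists>k<2 ^ n. S = blend (layers E s i) (layers E s (i + 1)) k \<and>
    T = blend (layers E s (i + 1)) (layers E s (i + 2)) k"
proof -
  let ?L = "layers E s"
  have S': "?L i \<subseteq> S" "S \<subseteq> ?L (i + 1)" using bfs_chain_layers[OF S] by auto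
  have T': "?L (i + 1) \<subseteq> T" "T \<subseteq> ?L (i + 2)" using bfs_chain_layers[OF chain_step[OF S T]] by auto
  have "T \<subseteq> {..<n}" "S \<subseteq> {..<n}"
    using bfs_chain_bounds[OF E s S] bfs_chain_bounds[OF E s chain_step[OF S T]] by auto
  then have "(S - ?L i) \<union> (T - ?L (i + 1)) \<subseteq> {..<n}" by blast
  then obtain k where k: "k < 2 ^ n" "set_decode k = (S - ?L i) \<union> (T - ?L (i + 1))"
    using ex_mask by blast
  \<comment> \<open>Inside \<open>?L (i + 1)\<close> the mask shows only \<open>S - ?L i\<close>.
    Inside \<open>?L (i + 2)\<close> it shows \<open>T - ?L (i + 1)\<close> and possibly vertices of
    \<open>S\<close>, which the union with \<open>?L (i + 1)\<close> absorbs.\<close>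
  have "S = blend (?L i) (?L (i + 1)) k" "T = blend (?L (i + 1)) (?L (i + 2)) k"
    unfolding blend_def k(2) using S' T' by auto
  then show ?thesis using k(1) by blast
qed

lemma chain_loops_collect:
  assumes E: "simple_graph {..<n} E" and bounds: "s < n" "i < n"
  shows "collects (\<lambda>m. chain_inv n E z m \<and> complete_upto n E s i m) (chain_keys n E s (Suc i))
    (run (For True 2 (For False 3 (For False 4 chain_body))) (\<rho>(0 := s, 1 := i)))"
proof -
  let ?S = "blend (layers E s i) (layers E s (i + 1))"
    and ?T = "blend (layers E s (i + 1)) (layers E s (i + 2))"
  let ?X = "\<lambda>k q p. {key n s (?T k) p |_::unit. i + 1 < n \<and> bfs_chain E s i (?S k) q \<and>
      bfs_next E s (?S k) q (?T k) p}"
  have bnd: "bound b m = range_size b n" if "chain_inv n E z m \<and> complete_upto n E s i m" for b m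
    using that inputs_simps(5)[of n E z m b] unfolding chain_inv_def by simp
  have "collects (\<lambda>m. chain_inv n E z m \<and> complete_upto n E s i m) (\<Union>k<2 ^ n. \<Union>q<n. \<Union>p<n. ?X k q p)
    (run (For True 2 (For False 3 (For False 4 chain_body))) (\<rho>(0 := s, 1 := i)))"
    by (intro collects_For chain_body_collects[OF E]) (use bnd bounds in auto)
  moreover have "chain_keys n E s (Suc i) \<subseteq> (\<Union>k<2 ^ n. \<Union>q<n. \<Union>p<n. ?X k q p)"
  proof
    fix x assume "x \<in> chain_keys n E s (Suc i)"
    then obtain T p where x: "x = key n s T p" "i + 1 < n" "bfs_chain E s (Suc i) T p"
      unfolding chain_keys_def by auto
    from x(3) obtain S q where S: "bfs_chain E s i S q" "bfs_next E s S q T p"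
      by (cases rule: bfs_chain.cases) auto
    obtain k where k: "k < 2 ^ n" "S = ?S k" "T = ?T k"
      using chain_pair_mask[OF E bounds(1) S] by blast
    have "q < n" "p < n" using bfs_chain_bounds(2)[OF E bounds(1)] S(1) x(3) by auto
    moreover have "x \<in> ?X k q p" using x S k by blast
    ultimately show "x \<in> (\<Union>k<2 ^ n. \<Union>q<n. \<Union>p<n. ?X k q p)" using k(1) by blast
  qed
  ultimately show ?thesis by (rule collects_subset)
qed

lemma complete_upto_Suc:
  "complete_upto n E s (Suc k) m \<longleftrightarrow> complete_upto n E s k m \<and> (\<forall>x\<in>chain_keys n E s (Suc k). m 6 x \<noteq> 0)"
  by (auto simp: complete_upto_def le_Suc_eq)

text \<open>Only the order of the loop over \<open>i\<close> matters: round \<open>i\<close> turns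
  completeness up to length \<open>i\<close> into completeness up to \<open>Suc i\<close>.\<close>

lemma chain_stm_collects:
  assumes E: "simple_graph {..<n} E"
  shows "collects (chain_inv n E z) (\<Union>s<n. \<Union>i\<in>{0<..<n}. chain_keys n E s i) (run chain_stm \<rho>)"
  unfolding chain_stm_def
proof (rule collects_For)
  fix s assume s: "s < n"
  let ?p = "For True 2 (For False 3 (For False 4 chain_body))"
  show "collects (chain_inv n E z) (\<Union>i\<in>{0<..<n}. chain_keys n E s i) (run (For False 1 ?p) (\<rho>(0 := s)))"
    unfolding collects_def
  proof (intro allI impI)
    fix m assume m: "chain_inv n E z m"
    let ?m = "run (For False 1 ?p) (\<rho>(0 := s)) m"
    let ?I = "\<lambda>k m'. (chain_inv n E z m' \<and> complete_upto n E s k m') \<and> (\<forall>x. m 6 x \<noteq> 0 \<longrightarrow> m' 6 x \<noteq> 0)"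
    have "?I n ?m"
    proof (rule run_For[where I = ?I])
      show "bound False m = n" using m inputs_simps(5)[of n E z m False] unfolding chain_inv_def by simp
      show "?I 0 m" using m by (simp add: complete_upto_def)
      fix i m' assume i: "i < n" and I: "?I i m'"
      note new = collectsD[OF chain_loops_collect[OF E s i, of z \<rho>], OF conjunct1[OF I]]
      show "?I (Suc i) (run ?p (\<rho>(0 := s, 1 := i)) m')"
        unfolding complete_upto_Suc
      proof (intro conjI ballI allI impI)
        fix x assume "m 6 x \<noteq> 0"
        then have "m' 6 x \<noteq> 0" using I by simp
        then show "run ?p (\<rho>(0 := s, 1 := i)) m' 6 x \<noteq> 0" by (rule new(2))
      qed (use new(1,3) in \<open>simp_all del: run.simps(2)\<close>)
    qed
    then show "chain_inv n E z ?m \<and> (\<forall>x. m 6 x \<noteq> 0 \<longrightarrow> ?m 6 x \<noteq> 0) \<and>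
        (\<forall>x\<in>(\<Union>i\<in>{0<..<n}. chain_keys n E s i). ?m 6 x \<noteq> 0)"
      unfolding complete_upto_def by auto
  qed
next
  fix m assume "chain_inv n E z m"
  then show "bound False m = n" using inputs_simps(5)[of n E z m False] unfolding chain_inv_def by simp
qed

definition bfs_tm :: tm where
  "bfs_tm = ex_tm False 0 (entry_tm all_but_goal_tm goal_tm)"

text \<open>The alternative with the empty set covers the graph with a single vertex, where the
  chain has length 0.\<close>

lemma holds_bfs_tm:
  assumes m: "inputs n E z m" and z: "z < n"
  shows "holds bfs_tm \<rho> m \<longleftrightarrow>
    (\<exists>s<n. m 6 (key n s ({..<n} - {z}) z) \<noteq> 0 \<or> {..<n} - {z} = {} \<and> z = s)"
proof -
  have code: "tval all_but_goal_tm \<rho>' m = set_encode ({..<n} - {z})" for \<rho>'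
    using tval_all_but_goal(1)[OF m z, of \<rho>'] set_decode_inverse by metis
  have "set_encode ({..<n} - {z}) = 0 \<longleftrightarrow> {..<n} - {z} = {}"
    using set_encode_eq[of "{..<n} - {z}" "{}"] by simp
  then show ?thesis
    by (simp only: bfs_tm_def entry_tm_def key_tm_def key_def holds_simps holds_quantifiers[OF m]
        tval_pair[OF m] code tval_input_tms[OF m] tval.simps fun_upd_same if_False)
qed

lemma solvable_bfs:
  "solvable_in_exp2_poly_time (\<lambda>V E z. is_end_vertex (bfs_ordering V E) z)"
proof (rule solvable_compile[where p = "Then layers_stm chain_stm" and a = bfs_tm and \<rho> = "\<lambda>_. 0"])
  fix n z :: nat and E assume E: "simple_graph {..<n} E" and z: "z < n"
  let ?V = "{..<n}" and ?m0 = "start_memory n E z"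
  define m1 where "m1 = run layers_stm (\<lambda>_. 0) ?m0"
  define m2 where "m2 = run chain_stm (\<lambda>_. 0) m1"
  have zero: "?m0 5 = (\<lambda>_. 0)" "?m0 6 = (\<lambda>_. 0)" by (auto simp: start_memory_def input_memory_def)
  have wf: "wf_stm 0 layers_stm"
    by (simp add: layers_stm_def layer_step_tm_def layer_tm_def pair_tm_def tm_defs)
  have in1: "inputs n E z m1" unfolding m1_def by (rule inputs_run[OF inputs_start wf])
  have "row n m1 s i = layers E s i" if "s < n" "i \<le> n" for s i
  proof -
    have "\<forall>v<n. layer_ok E n m1 s i v"
      using run_layers_stm[OF inputs_start E zero(1)] that unfolding m1_def by blast
    moreover have "layers E s i \<subseteq> ?V" using layers_subset[OF E] that(1) by simp
    ultimately show ?thesis unfolding row_def layer_ok_def by auto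
  qed
  \<comment> \<open>The layers are written to array 5 only, so the chain table is still empty and
    hence trivially sound.\<close>
  moreover have "m1 6 = (\<lambda>_. 0)"
  proof -
    have "fold f is m 6 = m 6" if "\<And>i m. f i m 6 = m 6" for f :: "nat \<Rightarrow> memory \<Rightarrow> memory" and "is" m
      using that by (induction "is" arbitrary: m) auto
    then show ?thesis unfolding m1_def layers_stm_def by (simp add: zero)
  qed
  ultimately have inv1: "chain_inv n E z m1" using in1 unfolding chain_inv_def by simp
  have inv: "chain_inv n E z m2"
    and compl: "x \<in> (\<Union>s<n. \<Union>i\<in>{0<..<n}. chain_keys n E s i) \<Longrightarrow> m2 6 x \<noteq> 0" for x
    unfolding m2_def using collectsD[OF chain_stm_collects[OF E, of z "\<lambda>_. 0"], OF inv1] by simp_all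
  have in2: "inputs n E z m2"
    and sound: "\<forall>s<n. \<forall>T\<subseteq>?V. \<forall>p<n. m2 6 (key n s T p) \<noteq> 0 \<longrightarrow> (\<exists>i. bfs_chain E s i T p)"
    using inv unfolding chain_inv_def by simp_all
  have "holds bfs_tm (\<lambda>_. 0) m2 \<longleftrightarrow> is_end_vertex (bfs_ordering ?V E) z"
  proof
    assume "holds bfs_tm (\<lambda>_. 0) m2"
    then obtain s where s: "s < n" "m2 6 (key n s (?V - {z}) z) \<noteq> 0 \<or> ?V - {z} = {} \<and> z = s"
      unfolding holds_bfs_tm[OF in2 z] by (elim exE conjE)
    have "\<exists>i. bfs_chain E s i (?V - {z}) z"
    proof (cases "m2 6 (key n s (?V - {z}) z) \<noteq> 0")
      case True
      then show ?thesis using sound s(1) z by simp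
    next
      case False
      with s(2) have "?V - {z} = {}" "z = s" by argo+
      then show ?thesis using chain_start[of E s] by (simp only:) blast
    qed
    then show "is_end_vertex (bfs_ordering ?V E) z"
      using end_vertex_of_bfs_chain[OF E] s(1) z by blast
  next
    assume "is_end_vertex (bfs_ordering ?V E) z"
    then obtain s i where s: "s < n" "i < n" "bfs_chain E s i (?V - {z}) z"
      using bfs_chain_of_end_vertex[OF E, of z] by auto
    have "m2 6 (key n s (?V - {z}) z) \<noteq> 0 \<or> ?V - {z} = {} \<and> z = s"
    proof (cases "i = 0")
      case True
      then show ?thesis using s(3) unfolding True bfs_chain_0 by blast
    next
      case False
      then have "key n s (?V - {z}) z \<in> chain_keys n E s i" using s unfolding chain_keys_def by blast
      moreover have "i \<in> {0<..<n}" "s \<in> ?V" using False s by auto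
      ultimately have "m2 6 (key n s (?V - {z}) z) \<noteq> 0" by (intro compl UN_I)
      then show ?thesis ..
    qed
    then show "holds bfs_tm (\<lambda>_. 0) m2"
      unfolding holds_bfs_tm[OF in2 z] by (intro exI[of _ s] conjI s(1))
  qed
  then show "tval bfs_tm (\<lambda>_. 0) (run (Then layers_stm chain_stm) (\<lambda>_. 0) ?m0) \<noteq> 0 \<longleftrightarrow>
      is_end_vertex (bfs_ordering ?V E) z"
    unfolding holds_def m2_def m1_def run.simps .
qed (simp_all add: layers_stm_def layer_step_tm_def layer_tm_def pair_tm_def chain_stm_def chain_body_def
    bfs_tm_def entry_tm_def key_tm_def mask_tm_def source_tm_def target_tm_def visited_tm_def next_tm_def
    tm_defs)

theorem theorem4:
  "solvable_in_exp2_poly_time (\<lambda>V E z. is_end_vertex (mcs_ordering V E) z)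
   \<and> solvable_in_exp2_poly_time (\<lambda>V E z. is_end_vertex (bfs_ordering V E) z)
   \<and> solvable_in_exp2_poly_time (\<lambda>V E z. is_end_vertex (dfs_ordering V E) z)"
  using solvable_mcs solvable_bfs solvable_dfs by blast

end
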